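(* Suppose $U$ is a domain (a connected open subset) in a connected noncompact Riemannian manifold $(M,g)$, $C$ is a connected noncompact closed subset of $M$ with $C\subset U$, and $\rho$ is a positive continuous function on $M$. Then there exists a nonnegative $C^\infty$ subharmonic function $\varphi$ on $M$ such that $\varphi\equiv 0$ on $M\setminus U$, and $\varphi>\rho$ and $\Delta_g\varphi>\rho$ on $C$.
   Context: For a Riemannian manifold $(M,g)$ of dimension $n$, the Laplace operator is given in local coordinates by $$\Delta_g\varphi=\frac{1}{\sqrt G}\sum_{i,j=1}^n\frac{\partial}{\partial x_i}\Bigl[g^{ij}\sqrt G\,\frac{\partial\varphi}{\partial x_j}\Bigr],$$ where $G=\det(g_{ij})$ and $(g^{ij})=(g_{ij})^{-1}$. A $C^2$ real-valued function $\varphi$ is subharmonic if $\Delta_g\varphi\ge 0$. *)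

theory Defs
  imports "HOL-Analysis.Analysis"
begin

subsection \<open>Functions of class \<open>C\<^sup>k\<close> on open subsets of Euclidean space\<close>

definition partial :: "'n::finite \<Rightarrow> (real^'n \<Rightarrow> real) \<Rightarrow> real^'n \<Rightarrow> real"
  where "partial i f x = deriv (\<lambda>t. f (x + t *\<^sub>R axis i 1)) 0"

text \<open>Only meaningful for open \<open>S\<close>.\<close>

primrec Ck_on :: "nat \<Rightarrow> (real^'n::finite) set \<Rightarrow> (real^'n \<Rightarrow> real) \<Rightarrow> bool"
  where
    "Ck_on 0 S f \<longleftrightarrow> continuous_on S f"
  | "Ck_on (Suc k) S f \<longleftrightarrow> f differentiable_on S \<and> (\<forall>i. Ck_on k S (partial i f))"

definition Cinf_on :: "(real^'n::finite) set \<Rightarrow> (real^'n \<Rightarrow> real) \<Rightarrow> bool"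
  where "Cinf_on S f \<longleftrightarrow> (\<forall>k. Ck_on k S f)"

subsection \<open>Smooth manifolds\<close>

text \<open>The underlying set of a manifold is a whole type. A chart is a pair of an open set and
  a coordinate map, whose values outside that open set are irrelevant.\<close>

type_synonym ('a, 'n) chart = "'a set \<times> ('a \<Rightarrow> (real, 'n) vec)"

abbreviation chart_dom :: "('a, 'n::finite) chart \<Rightarrow> 'a set"
  where "chart_dom c \<equiv> fst c"

abbreviation coords :: "('a, 'n::finite) chart \<Rightarrow> 'a \<Rightarrow> real^'n"
  where "coords c \<equiv> snd c"

definition chart_im :: "('a, 'n::finite) chart \<Rightarrow> (real^'n) set"
  where "chart_im c = coords c ` chart_dom c"

definition chart_inv :: "('a, 'n::finite) chart \<Rightarrow> real^'n \<Rightarrow> 'a"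
  where "chart_inv c = inv_into (chart_dom c) (coords c)"

definition transition :: "('a, 'n::finite) chart \<Rightarrow> ('a, 'n) chart \<Rightarrow> real^'n \<Rightarrow> real^'n"
  where "transition c d = coords d \<circ> chart_inv c"

locale smooth_manifold =
  fixes atlas :: "('a::{t2_space, second_countable_topology}, 'n::finite) chart set"
  assumes open_dom: "c \<in> atlas \<Longrightarrow> open (chart_dom c)"
    and open_im: "c \<in> atlas \<Longrightarrow> open (chart_im c)"
    and homeo: "c \<in> atlas \<Longrightarrow> homeomorphism (chart_dom c) (chart_im c) (coords c) (chart_inv c)"
    and cover: "(\<Union>c\<in>atlas. chart_dom c) = UNIV"
    and compat: "c \<in> atlas \<Longrightarrow> d \<in> atlas \<Longrightarrow>
      Cinf_on (coords c ` (chart_dom c \<inter> chart_dom d)) (\<lambda>x. transition c d x $ i)"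

definition Ck_fun :: "('a, 'n::finite) chart set \<Rightarrow> nat \<Rightarrow> ('a \<Rightarrow> real) \<Rightarrow> bool"
  where "Ck_fun atlas k f \<longleftrightarrow> (\<forall>c\<in>atlas. Ck_on k (chart_im c) (f \<circ> chart_inv c))"

definition Cinf_fun :: "('a, 'n::finite) chart set \<Rightarrow> ('a \<Rightarrow> real) \<Rightarrow> bool"
  where "Cinf_fun atlas f \<longleftrightarrow> (\<forall>k. Ck_fun atlas k f)"

subsection \<open>Riemannian metrics and the Laplace operator\<close>

text \<open>A metric is given by its component matrices: \<open>g c p $ i $ j\<close> is \<open>g\<^sub>i\<^sub>j\<close> at the point \<open>p\<close>
  with respect to the coordinates of the chart \<open>c\<close>. The last axiom below is the transformation
  law of a covariant 2-tensor.\<close>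

locale riemannian_manifold = smooth_manifold atlas
  for atlas :: "('a::{t2_space, second_countable_topology}, 'n::finite) chart set" +
  fixes g :: "('a, 'n) chart \<Rightarrow> 'a \<Rightarrow> real^'n^'n"
  assumes metric_smooth: "c \<in> atlas \<Longrightarrow> Cinf_on (chart_im c) (\<lambda>x. g c (chart_inv c x) $ i $ j)"
    and metric_sym: "c \<in> atlas \<Longrightarrow> p \<in> chart_dom c \<Longrightarrow> transpose (g c p) = g c p"
    and metric_pos: "c \<in> atlas \<Longrightarrow> p \<in> chart_dom c \<Longrightarrow> v \<noteq> 0 \<Longrightarrow> v \<bullet> (g c p *v v) > 0"
    and metric_transform:
      "c \<in> atlas \<Longrightarrow> d \<in> atlas \<Longrightarrow> p \<in> chart_dom c \<inter> chart_dom d \<Longrightarrow>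
       g c p $ i $ j =
         (\<Sum>a\<in>UNIV. \<Sum>b\<in>UNIV.
            partial i (\<lambda>x. transition c d x $ a) (coords c p) *
            partial j (\<lambda>x. transition c d x $ b) (coords c p) * g d p $ a $ b)"

definition laplacian_in_chart ::
    "(('a, 'n) chart \<Rightarrow> 'a \<Rightarrow> real^'n^'n) \<Rightarrow> ('a, 'n::finite) chart \<Rightarrow> ('a \<Rightarrow> real) \<Rightarrow> 'a \<Rightarrow> real"
  where "laplacian_in_chart g c f p =
    (let G = (\<lambda>x. det (g c (chart_inv c x)));
         ginv = (\<lambda>x. matrix_inv (g c (chart_inv c x)))
     in 1 / sqrt (G (coords c p)) *
        (\<Sum>i\<in>UNIV. \<Sum>j\<in>UNIV.
           partial i (\<lambda>x. ginv x $ i $ j * sqrt (G x) * partial j (f \<circ> chart_inv c) x)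
             (coords c p)))"

text \<open>The value of the Laplacian at \<open>p\<close> is the number computed in every chart around \<open>p\<close>
  (for a \<open>C\<^sup>2\<close> function on a Riemannian manifold all these charts give the same number).\<close>

definition laplacian ::
    "('a, 'n::finite) chart set \<Rightarrow> (('a, 'n) chart \<Rightarrow> 'a \<Rightarrow> real^'n^'n) \<Rightarrow> ('a \<Rightarrow> real) \<Rightarrow> 'a \<Rightarrow> real"
  where "laplacian atlas g f p =
    (THE L. \<forall>c\<in>atlas. p \<in> chart_dom c \<longrightarrow> laplacian_in_chart g c f p = L)"

definition subharmonic ::
    "('a, 'n::finite) chart set \<Rightarrow> (('a, 'n) chart \<Rightarrow> 'a \<Rightarrow> real^'n^'n) \<Rightarrow> ('a \<Rightarrow> real) \<Rightarrow> bool"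
  where "subharmonic atlas g f \<longleftrightarrow> Ck_fun atlas 2 f \<and> (\<forall>p. laplacian atlas g f p \<ge> 0)"

end

theory Submission
  imports Defs
begin

text \<open>On a connected noncompact manifold the maximum principle forbids a nonzero nonnegative
subharmonic function with compact support. It fails to do so by very little: inside a coordinate
ball there is a nonnegative smooth bump that is strictly subharmonic wherever it is positive, except
in an arbitrarily small neighbourhood of the centre, the core of the bump
(\<open>bump_subharmonic_off_core\<close>). The defect on the core is repaired by adding a large multiple of
another bump that is strictly subharmonic there. The second bump has a defect on its own core, which
a third bump repairs, and so on. As \<open>C\<close> is connected and not compact, these chains of repairs can
be run along \<open>C\<close> to infinity, where no defect is left.

To organise the repairs, cover \<open>C\<close> by a locally finite sequence of coordinate balls \<open>V i\<close> that lie
in \<open>U\<close> and meet \<open>C\<close> (\<open>locally_finite_ball_sequence\<close>). The graph in which overlapping balls are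
adjacent is infinite, locally finite and connected. In such a graph every vertex \<open>i\<close> can be given an
adjacent successor \<open>s i\<close> so that the relation between \<open>i\<close> and \<open>s i\<close> is well-founded
(\<open>ex_wf_successor\<close>). Put the core of the \<open>i\<close>-th bump \<open>\<alpha> i\<close> into \<open>V i \<inter> V (s i)\<close>, away from the core
of \<open>\<alpha> (s i)\<close>, and let \<open>\<phi> = (\<Sum>i. c i * \<alpha> i)\<close>. The coefficient \<open>c k\<close> has to dominate the defects
of the finitely many bumps with successor \<open>k\<close> and the bound of \<open>\<rho>\<close> on \<open>V k\<close>. This is a recursion
over the predecessors of \<open>k\<close>, so well-foundedness yields the coefficients (\<open>ex_coefficients\<close>).

The Laplacian of a function is the common value of its coordinate expressions, so the argument
also rests on the fact that these expressions agree (\<open>laplacian_in_chart_invariant\<close>). That is the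
coordinate invariance of an operator in divergence form, and its heart is the Piola
identity (\<open>piola_identity\<close>): the rows of the cofactor matrix of a Jacobian are divergence free.\<close>

section \<open>Calculus of functions of class \<open>C\<^sup>k\<close>\<close>

lemma partial_has_derivative:
  fixes f :: "real^'n::finite \<Rightarrow> real"
  assumes "(f has_derivative f') (at x)"
  shows "partial i f x = f' (axis i 1)"
proof -
  have "((\<lambda>t. x + t *\<^sub>R axis i 1) has_derivative (\<lambda>t. t *\<^sub>R axis i 1)) (at (0::real))"
    by (auto intro!: derivative_eq_intros)
  from has_derivative_compose[OF this, of f f'] assms
  have "((\<lambda>t. f (x + t *\<^sub>R axis i 1)) has_derivative (\<lambda>t. f' (t *\<^sub>R axis i 1))) (at 0)"
    by simp
  moreover have "(\<lambda>t. f' (t *\<^sub>R axis i 1)) = (*) (f' (axis i 1))"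
    using linear_scale[OF has_derivative_linear[OF assms]] by (auto simp: mult.commute)
  ultimately have "((\<lambda>t. f (x + t *\<^sub>R axis i 1)) has_real_derivative f' (axis i 1)) (at 0)"
    by (simp add: has_field_derivative_def)
  then show ?thesis
    unfolding partial_def by (rule DERIV_imp_deriv)
qed

lemma has_derivative_partials:
  fixes f :: "real^'n::finite \<Rightarrow> real"
  assumes "f differentiable (at x)"
  shows "(f has_derivative (\<lambda>v. \<Sum>i\<in>UNIV. v $ i * partial i f x)) (at x)"
proof -
  obtain f' where f': "(f has_derivative f') (at x)"
    using assms by (auto simp: differentiable_def)
  have "f' v = (\<Sum>i\<in>UNIV. v $ i * partial i f x)" for v
  proof -
    have "f' v = f' (\<Sum>i\<in>UNIV. (v $ i) *\<^sub>R axis i 1)"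
      by (simp add: basis_expansion flip: scalar_mult_eq_scaleR)
    also have "\<dots> = (\<Sum>i\<in>UNIV. v $ i * f' (axis i 1))"
      using has_derivative_linear[OF f'] by (simp add: linear_sum linear_scale)
    finally show ?thesis
      by (simp add: partial_has_derivative[OF f'])
  qed
  then show ?thesis
    using f' by presburger
qed

lemma partial_cong:
  assumes "open S" "x \<in> S" "\<And>y. y \<in> S \<Longrightarrow> f y = h y"
  shows "partial i f x = partial i h x"
  unfolding partial_def
proof (rule deriv_cong_ev)
  have "continuous (at 0) (\<lambda>t::real. x + t *\<^sub>R axis i 1)"
    by (intro continuous_intros)
  then have "((\<lambda>t::real. x + t *\<^sub>R axis i 1) \<longlongrightarrow> x) (nhds 0)"
    using tendsto_at_iff_tendsto_nhds[of "\<lambda>t::real. x + t *\<^sub>R axis i 1" 0] by (simp add: isCont_def)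
  from topological_tendstoD[OF this assms(1,2)]
  show "\<forall>\<^sub>F t in nhds (0::real). f (x + t *\<^sub>R axis i 1) = h (x + t *\<^sub>R axis i 1)"
    by (rule eventually_mono) (use assms(3) in blast)
qed simp

lemma partial_const [simp]: "partial i (\<lambda>x. c) x = 0"
  by (simp add: partial_def)

lemma partial_coordinate:
  "partial i (\<lambda>x. x $ j) x = (if i = j then 1 else 0)"
  by (subst partial_has_derivative[of _ "\<lambda>v. v $ j"])
     (auto intro!: bounded_linear_imp_has_derivative bounded_linear_vec_nth simp: axis_def)

lemma partial_add:
  assumes "f differentiable (at x)" "h differentiable (at x)"
  shows "partial i (\<lambda>x. f x + h x) x = partial i f x + partial i h x"
proof -
  obtain f' h' where *: "(f has_derivative f') (at x)" "(h has_derivative h') (at x)"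
    using assms by (auto simp: differentiable_def)
  then show ?thesis
    using partial_has_derivative[OF has_derivative_add[OF *]] by (simp add: partial_has_derivative)
qed

lemma partial_mult:
  assumes "f differentiable (at x)" "h differentiable (at x)"
  shows "partial i (\<lambda>x. f x * h x) x = partial i f x * h x + f x * partial i h x"
proof -
  obtain f' h' where *: "(f has_derivative f') (at x)" "(h has_derivative h') (at x)"
    using assms by (auto simp: differentiable_def)
  then show ?thesis
    using partial_has_derivative[OF has_derivative_mult[OF *]] by (simp add: partial_has_derivative)
qed

lemma partial_cmult:
  assumes "f differentiable (at x)"
  shows "partial i (\<lambda>x. c * f x) x = c * partial i f x"
  using partial_mult[of "\<lambda>x. c", OF _ assms] by simp

lemma differentiable_sum_real:
  fixes f :: "'b \<Rightarrow> real^'n::finite \<Rightarrow> real"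
  assumes "\<And>j. j \<in> A \<Longrightarrow> f j differentiable (at x)"
  shows "(\<lambda>x. \<Sum>j\<in>A. f j x) differentiable (at x)"
  using assms by (induction A rule: infinite_finite_induct) auto

lemma partial_sum:
  fixes f :: "'b \<Rightarrow> real^'n::finite \<Rightarrow> real"
  assumes "\<And>j. j \<in> A \<Longrightarrow> f j differentiable (at x)"
  shows "partial i (\<lambda>x. \<Sum>j\<in>A. f j x) x = (\<Sum>j\<in>A. partial i (f j) x)"
  using assms
  by (induction A rule: infinite_finite_induct) (auto simp: partial_add differentiable_sum_real)

lemma partial_chain_real:
  fixes f :: "real^'n::finite \<Rightarrow> real"
  assumes "(h has_real_derivative d) (at (f x))" "f differentiable (at x)"
  shows "partial i (\<lambda>x. h (f x)) x = d * partial i f x"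
proof -
  obtain f' where f': "(f has_derivative f') (at x)"
    using assms(2) by (auto simp: differentiable_def)
  show ?thesis
    using partial_has_derivative[OF has_derivative_compose[OF f', of h "(*) d"]] assms(1)
    by (simp add: has_field_derivative_def partial_has_derivative[OF f'])
qed

lemma has_derivative_components:
  fixes T :: "real^'n::finite \<Rightarrow> real^'m::finite"
  assumes "\<And>a. (\<lambda>x. T x $ a) differentiable (at x)"
  shows "(T has_derivative (\<lambda>v. \<chi> a. \<Sum>i\<in>UNIV. v $ i * partial i (\<lambda>x. T x $ a) x)) (at x)"
proof (subst has_derivative_componentwise_within, rule ballI)
  fix b :: "real^'m" assume "b \<in> Basis"
  then obtain a where b: "b = axis a 1"
    by (auto simp: Basis_vec_def)
  show "((\<lambda>x. T x \<bullet> b) has_derivative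
      (\<lambda>v. (\<chi> a. \<Sum>i\<in>UNIV. v $ i * partial i (\<lambda>x. T x $ a) x) \<bullet> b)) (at x)"
    using has_derivative_partials[OF assms[of a]] by (simp add: b inner_axis)
qed

lemma partial_chain:
  fixes T :: "real^'n::finite \<Rightarrow> real^'m::finite"
  assumes "\<And>a. (\<lambda>x. T x $ a) differentiable (at x)" "f differentiable (at (T x))"
  shows "partial i (\<lambda>x. f (T x)) x = (\<Sum>a\<in>UNIV. partial a f (T x) * partial i (\<lambda>x. T x $ a) x)"
  using partial_has_derivative[OF has_derivative_compose[OF has_derivative_components[of T, OF assms(1)]
      has_derivative_partials[OF assms(2)]], of i]
  by (simp add: axis_def if_distrib[where f="\<lambda>u. u * _"] mult.commute cong: if_cong)

lemma differentiable_chain: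
  fixes T :: "real^'n::finite \<Rightarrow> real^'m::finite" and f :: "real^'m \<Rightarrow> real"
  assumes "\<And>a. (\<lambda>x. T x $ a) differentiable (at x)" "f differentiable (at (T x))"
  shows "(\<lambda>x. f (T x)) differentiable (at x)"
  using has_derivative_compose[OF has_derivative_components[of T, OF assms(1)]
      has_derivative_partials[OF assms(2)]]
  by (auto simp: differentiable_def)

lemma Ck_on_subset: "Ck_on k S f \<Longrightarrow> N \<subseteq> S \<Longrightarrow> Ck_on k N f"
  by (induction k arbitrary: f) (auto intro: continuous_on_subset differentiable_on_subset)

lemma Ck_on_Suc_imp: "Ck_on (Suc k) S f \<Longrightarrow> Ck_on k S f"
  by (induction k arbitrary: f) (auto intro: differentiable_imp_continuous_on)

lemma Ck_on_mono: "Ck_on k S f \<Longrightarrow> j \<le> k \<Longrightarrow> Ck_on j S f"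
  by (induction k) (use Ck_on_Suc_imp le_Suc_eq in blast)+

lemma Ck_on_cong:
  assumes "open S" "\<And>x. x \<in> S \<Longrightarrow> f x = h x"
  shows "Ck_on k S f \<longleftrightarrow> Ck_on k S h"
  using assms(2)
proof (induction k arbitrary: f h)
  case 0
  then show ?case by (simp cong: continuous_on_cong)
next
  case (Suc k)
  have *: "u differentiable_on S \<Longrightarrow> v differentiable_on S"
    if "\<And>x. x \<in> S \<Longrightarrow> u x = v x" for u v :: "real^'a \<Rightarrow> real"
    using that by (auto simp: differentiable_on_def intro: differentiable_transform_within[OF _ zero_less_one])
  have "Ck_on k S (partial i f) \<longleftrightarrow> Ck_on k S (partial i h)" for i
    by (rule Suc.IH) (rule partial_cong[OF assms(1) _ Suc.prems])
  then show ?case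
    using *[of f h] *[of h f] Suc.prems by auto
qed

lemma Ck_on_locally:
  assumes "\<And>x. x \<in> S \<Longrightarrow> \<exists>N. open N \<and> x \<in> N \<and> Ck_on k N f"
  shows "Ck_on k S f"
  using assms
proof (induction k arbitrary: f)
  case 0
  have "isCont f x" if x: "x \<in> S" for x
    using 0[OF x] by (auto simp: continuous_on_eq_continuous_at)
  then show ?case
    by (simp add: continuous_at_imp_continuous_on)
next
  case (Suc k)
  have "f differentiable (at x within S)" if x: "x \<in> S" for x
  proof -
    obtain N where "open N" "x \<in> N" "f differentiable_on N"
      using Suc.prems[OF x] by auto
    then show ?thesis
      by (simp add: differentiable_on_eq_differentiable_at differentiable_at_withinI)
  qed
  moreover have "Ck_on k S (partial i f)" for i
  proof (rule Suc.IH)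
    show "\<exists>N. open N \<and> x \<in> N \<and> Ck_on k N (partial i f)" if "x \<in> S" for x
      using Suc.prems[OF that] by auto
  qed
  ultimately show ?case
    by (simp add: differentiable_on_def)
qed

lemma Ck_on_SucD:
  assumes "Ck_on (Suc k) S f" "open S" "x \<in> S"
  shows "f differentiable (at x)"
  using assms by (simp add: differentiable_on_eq_differentiable_at)

lemma Ck_on_SucI:
  assumes "open S" "\<And>x. x \<in> S \<Longrightarrow> f differentiable (at x)"
    "\<And>i x. x \<in> S \<Longrightarrow> partial i f x = f' i x" "\<And>i. Ck_on k S (f' i)"
  shows "Ck_on (Suc k) S f"
proof -
  have "Ck_on k S (partial i f)" for i
    using Ck_on_cong[of S "partial i f" "f' i" k] assms by auto
  then show ?thesis
    using assms(1,2) by (simp add: differentiable_on_eq_differentiable_at)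
qed

lemma Ck_on_const:
  fixes S :: "(real^'n::finite) set"
  shows "Ck_on k S (\<lambda>x. c)"
proof (induction k arbitrary: c)
  case (Suc k)
  have "partial i (\<lambda>x. c) = (\<lambda>x. 0)" for i :: 'n by auto
  then show ?case using Suc by simp
qed simp

lemma Ck_on_coordinate: "Ck_on k S (\<lambda>x. x $ j)"
proof (cases k)
  case 0
  then show ?thesis by (auto intro!: continuous_intros)
next
  case (Suc k')
  have "partial i (\<lambda>x. x $ j) = (\<lambda>x. if i = j then 1 else 0)" for i :: 'a
    by (auto simp: partial_coordinate)
  moreover have "(\<lambda>x. x $ j) differentiable_on S"
    by (auto simp: differentiable_on_def intro!: bounded_linear_imp_differentiable bounded_linear_vec_nth)
  ultimately show ?thesis using Suc by (auto simp: Ck_on_const)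
qed

lemma Ck_on_add:
  assumes "open S" "Ck_on k S f" "Ck_on k S h"
  shows "Ck_on k S (\<lambda>x. f x + h x)"
  using assms(2,3)
proof (induction k arbitrary: f h)
  case 0
  then show ?case by (auto intro!: continuous_intros)
next
  case (Suc k)
  note D = Suc.prems[THEN Ck_on_SucD, OF assms(1)]
  show ?case
    by (rule Ck_on_SucI[OF assms(1), where f' = "\<lambda>i x. partial i f x + partial i h x"])
       (use Suc in \<open>auto simp: partial_add D\<close>)
qed

lemma Ck_on_mult:
  assumes "open S" "Ck_on k S f" "Ck_on k S h"
  shows "Ck_on k S (\<lambda>x. f x * h x)"
  using assms(2,3)
proof (induction k arbitrary: f h)
  case 0
  then show ?case by (auto intro!: continuous_intros)
next
  case (Suc k)
  note D = Suc.prems[THEN Ck_on_SucD, OF assms(1)]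
  show ?case
  proof (rule Ck_on_SucI[OF assms(1), where f' = "\<lambda>i x. partial i f x * h x + f x * partial i h x"])
    show "Ck_on k S (\<lambda>x. partial i f x * h x + f x * partial i h x)" for i
      by (intro Ck_on_add[OF assms(1)] Suc.IH) (use Suc.prems Suc.prems[THEN Ck_on_Suc_imp] in auto)
  qed (auto simp: partial_mult D)
qed

lemma Ck_on_sum:
  assumes "open S" "\<And>j. j \<in> A \<Longrightarrow> Ck_on k S (f j)"
  shows "Ck_on k S (\<lambda>x. \<Sum>j\<in>A. f j x)"
  using assms(2)
  by (induction A rule: infinite_finite_induct) (auto intro: Ck_on_const Ck_on_add[OF assms(1)])

lemma Ck_on_prod:
  assumes "open S" "\<And>j. j \<in> A \<Longrightarrow> Ck_on k S (f j)"
  shows "Ck_on k S (\<lambda>x. \<Prod>j\<in>A. f j x)"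
  using assms(2)
  by (induction A rule: infinite_finite_induct) (auto intro: Ck_on_const Ck_on_mult[OF assms(1)])

lemma Ck_on_inverse:
  assumes "open S" "Ck_on k S f" "\<And>x. x \<in> S \<Longrightarrow> f x \<noteq> 0"
  shows "Ck_on k S (\<lambda>x. inverse (f x))"
  using assms(2)
proof (induction k)
  case 0
  then show ?case using assms(3) by (auto intro!: continuous_intros)
next
  case (Suc k)
  note D = Ck_on_SucD[OF Suc.prems assms(1)]
  show ?case
  proof (rule Ck_on_SucI[OF assms(1),
        where f' = "\<lambda>i x. (- 1) * (inverse (f x) * inverse (f x)) * partial i f x"])
    show "Ck_on k S (\<lambda>x. (- 1) * (inverse (f x) * inverse (f x)) * partial i f x)" for i
      by (intro Ck_on_mult[OF assms(1)] Ck_on_const Suc.IH) (use Suc.prems Suc.prems[THEN Ck_on_Suc_imp] in auto)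
    show "partial i (\<lambda>x. inverse (f x)) x = (- 1) * (inverse (f x) * inverse (f x)) * partial i f x"
      if "x \<in> S" for i x
      using partial_chain_real[OF DERIV_inverse D, OF _ that, of i] assms(3)[OF that]
      by (simp add: power2_eq_square)
  qed (use D assms(3) in auto)
qed

lemma Ck_on_compose:
  fixes T :: "real^'n::finite \<Rightarrow> real^'m::finite"
  assumes "open S" "open S'" "T ` S \<subseteq> S'"
    "\<And>a. Ck_on k S (\<lambda>x. T x $ a)" "Ck_on k S' f"
  shows "Ck_on k S (\<lambda>x. f (T x))"
  using assms(4,5)
proof (induction k arbitrary: f)
  case 0
  have "continuous_on S T"
    using 0 continuous_on_vec_lambda[of S "\<lambda>a x. T x $ a"] by simp
  then show ?case
    using 0 assms(3) continuous_on_compose2 by (metis Ck_on.simps(1))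
next
  case (Suc k)
  have DT: "\<And>a x. x \<in> S \<Longrightarrow> (\<lambda>x. T x $ a) differentiable (at x)"
    using Ck_on_SucD[OF Suc.prems(1) assms(1)] .
  have Df: "\<And>x. x \<in> S \<Longrightarrow> f differentiable (at (T x))"
    using Ck_on_SucD[OF Suc.prems(2) assms(2)] assms(3) by blast
  show ?case
  proof (rule Ck_on_SucI[OF assms(1)])
    show "(\<lambda>x. f (T x)) differentiable (at x)" if "x \<in> S" for x
      by (rule differentiable_chain) (use DT Df that in auto)
    show "partial i (\<lambda>x. f (T x)) x = (\<Sum>a\<in>UNIV. partial a f (T x) * partial i (\<lambda>x. T x $ a) x)"
      if "x \<in> S" for x i
      by (rule partial_chain) (use DT Df that in auto)
    show "Ck_on k S (\<lambda>x. \<Sum>a\<in>UNIV. partial a f (T x) * partial i (\<lambda>x. T x $ a) x)" for i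
    proof (intro Ck_on_sum[OF assms(1)] Ck_on_mult[OF assms(1)])
      show "Ck_on k S (\<lambda>x. partial a f (T x))" for a
        by (rule Suc.IH) (use Suc.prems(1)[THEN Ck_on_Suc_imp] Suc.prems(2) in auto)
    qed (use Suc.prems in auto)
  qed
qed

text \<open>The outer function is given together with the sequence \<open>h\<close> of all its derivatives, so that the
induction can pass from \<open>h m\<close> to \<open>h (Suc m)\<close>.\<close>

lemma Ck_on_compose_real:
  fixes h :: "nat \<Rightarrow> real \<Rightarrow> real"
  assumes "open S" "Ck_on k S f" "\<And>m t. (h m has_real_derivative h (Suc m) t) (at t)"
  shows "Ck_on k S (\<lambda>x. h m (f x))"
  using assms(2)
proof (induction k arbitrary: m)
  case 0
  have "continuous_on UNIV (h m)"
    by (intro continuous_at_imp_continuous_on ballI DERIV_isCont[OF assms(3)])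
  then show ?case
    using 0 continuous_on_compose2[of UNIV "h m" S f] by auto
next
  case (Suc k)
  note D = Ck_on_SucD[OF Suc.prems assms(1)]
  show ?case
  proof (rule Ck_on_SucI[OF assms(1)])
    show "(\<lambda>x. h m (f x)) differentiable (at x)" if "x \<in> S" for x
      using D[OF that] assms(3)[of m "f x"] has_derivative_compose[of f _ x UNIV "h m"]
      unfolding has_field_derivative_def differentiable_def by blast
    show "partial i (\<lambda>x. h m (f x)) x = h (Suc m) (f x) * partial i f x" if "x \<in> S" for i x
      by (rule partial_chain_real[where h = "h m" and f = f, OF assms(3) D[OF that]])
    show "Ck_on k S (\<lambda>x. h (Suc m) (f x) * partial i f x)" for i
    proof (rule Ck_on_mult[OF assms(1)])
      show "Ck_on k S (\<lambda>x. h (Suc m) (f x))"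
        by (rule Suc.IH[OF Ck_on_Suc_imp[OF Suc.prems]])
    qed (use Suc.prems in auto)
  qed
qed

section \<open>Mixed partial derivatives and the derivative of the determinant\<close>

lemma Ck_on_differentiable:
  assumes "Ck_on k S f" "k > 0" "open S" "x \<in> S"
  shows "f differentiable (at x)"
  using assms Ck_on_SucD[of "k - 1" S f x] by simp

lemma DERIV_along_axis:
  fixes f :: "real^'n::finite \<Rightarrow> real"
  assumes "f differentiable (at (y + s *\<^sub>R axis i 1))"
  shows "((\<lambda>s. f (y + s *\<^sub>R axis i 1)) has_real_derivative partial i f (y + s *\<^sub>R axis i 1)) (at s)"
proof -
  have "((\<lambda>s. y + s *\<^sub>R axis i 1) has_derivative (\<lambda>t. t *\<^sub>R axis i 1)) (at s)"
    by (auto intro!: derivative_eq_intros)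
  from has_derivative_compose[OF this has_derivative_partials[OF assms]]
  show ?thesis
    by (simp add: has_field_derivative_def axis_def if_distrib[where f="\<lambda>u. u * _"]
        if_distrib[where f="\<lambda>u. _ * u"] mult.commute[of _ "partial i f _"] cong: if_cong)
qed

text \<open>Applying the mean value theorem in the direction \<open>i\<close> and then in the direction \<open>j\<close> turns the second
difference into a mixed derivative; the second difference itself is symmetric in \<open>i\<close> and \<open>j\<close>.\<close>

lemma second_difference_mean_value:
  fixes f :: "real^'n::finite \<Rightarrow> real"
  assumes f: "Ck_on 2 (ball x r) f" and h: "0 < h" "2 * h < r"
  shows "\<exists>\<xi>\<in>ball x r. f (x + h *\<^sub>R axis i 1 + h *\<^sub>R axis j 1) - f (x + h *\<^sub>R axis i 1)
      - f (x + h *\<^sub>R axis j 1) + f x = h * h * partial j (partial i f) \<xi>"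
proof -
  have f1: "Ck_on (Suc 1) (ball x r) f" and f2: "Ck_on (Suc 0) (ball x r) (partial i f)"
    using f by (simp_all add: numeral_2_eq_2)
  have near: "x + s *\<^sub>R axis i 1 + t *\<^sub>R axis j 1 \<in> ball x r"
    if "0 \<le> s" "s \<le> h" "0 \<le> t" "t \<le> h" for s t
  proof -
    have "norm (s *\<^sub>R axis i (1::real) + t *\<^sub>R axis j 1) \<le> s + t"
      using norm_triangle_ineq[of "s *\<^sub>R axis i (1::real)" "t *\<^sub>R axis j 1"] that by simp
    then have "dist x (x + s *\<^sub>R axis i 1 + t *\<^sub>R axis j 1) < r"
      using that h by (simp add: dist_norm add.assoc flip: norm_minus_cancel[of "_ + _"])
    then show ?thesis by simp
  qed
  let ?u = "\<lambda>s. f (x + s *\<^sub>R axis i 1 + h *\<^sub>R axis j 1) - f (x + s *\<^sub>R axis i 1)"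
  let ?u' = "\<lambda>s. partial i f (x + s *\<^sub>R axis i 1 + h *\<^sub>R axis j 1) - partial i f (x + s *\<^sub>R axis i 1)"
  have "(?u has_real_derivative ?u' s) (at s)" if "0 \<le> s" "s \<le> h" for s
  proof (rule DERIV_diff)
    show "((\<lambda>s. f (x + s *\<^sub>R axis i 1)) has_real_derivative partial i f (x + s *\<^sub>R axis i 1)) (at s)"
      by (rule DERIV_along_axis, rule Ck_on_SucD[OF f1]) (use near[of s 0] that h in auto)
    have "f differentiable (at (x + s *\<^sub>R axis i 1 + h *\<^sub>R axis j 1))"
      by (rule Ck_on_SucD[OF f1]) (use near[of s h] that h in auto)
    then show "((\<lambda>s. f (x + s *\<^sub>R axis i 1 + h *\<^sub>R axis j 1)) has_real_derivative
        partial i f (x + s *\<^sub>R axis i 1 + h *\<^sub>R axis j 1)) (at s)"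
      using DERIV_along_axis[of f "x + h *\<^sub>R axis j 1" s i] by (simp add: ac_simps)
  qed
  from MVT2[OF h(1) this] obtain s where s: "0 < s" "s < h" "?u h - ?u 0 = h * ?u' s"
    by auto
  let ?v = "\<lambda>t. partial i f (x + s *\<^sub>R axis i 1 + t *\<^sub>R axis j 1)"
  have "(?v has_real_derivative partial j (partial i f) (x + s *\<^sub>R axis i 1 + t *\<^sub>R axis j 1)) (at t)"
    if "0 \<le> t" "t \<le> h" for t
    by (rule DERIV_along_axis, rule Ck_on_SucD[OF f2]) (use near[of s t] that s in auto)
  from MVT2[OF h(1) this] obtain t where t: "0 < t" "t < h"
    "?v h - ?v 0 = h * partial j (partial i f) (x + s *\<^sub>R axis i 1 + t *\<^sub>R axis j 1)"
    by auto
  show ?thesis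
    by (rule bexI[OF _ near[of s t]]) (use s t in \<open>auto simp: algebra_simps\<close>)
qed

text \<open>By the symmetry of the second difference, the two mixed derivatives share values arbitrarily
close to \<open>x\<close>; continuity then forces them to agree at \<open>x\<close>.\<close>

lemma partial_commute:
  fixes f :: "real^'n::finite \<Rightarrow> real"
  assumes "open S" "x \<in> S" "Ck_on 2 S f"
  shows "partial i (partial j f) x = partial j (partial i f) x"
proof (rule ccontr)
  assume neq: "partial i (partial j f) x \<noteq> partial j (partial i f) x"
  let ?a = "partial i (partial j f)" and ?b = "partial j (partial i f)"
  define e where "e = \<bar>?a x - ?b x\<bar> / 2"
  have e: "e > 0" using neq by (simp add: e_def)
  have "isCont ?a x" "isCont ?b x"
    using assms by (auto simp: numeral_2_eq_2 continuous_on_eq_continuous_at)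
  then obtain d1 d2 where d: "d1 > 0" "\<And>y. dist y x < d1 \<Longrightarrow> dist (?a y) (?a x) < e"
    "d2 > 0" "\<And>y. dist y x < d2 \<Longrightarrow> dist (?b y) (?b x) < e"
    using e unfolding continuous_at_eps_delta by metis
  obtain d3 where d3: "d3 > 0" "ball x d3 \<subseteq> S"
    using assms(1,2) open_contains_ball by blast
  define r where "r = min d1 (min d2 d3)"
  have r: "r > 0" using d d3 by (simp add: r_def)
  have C2: "Ck_on 2 (ball x r) f"
    using assms(3) by (rule Ck_on_subset) (use d3 in \<open>auto simp: r_def\<close>)
  obtain \<xi> \<eta> where xe: "\<xi> \<in> ball x r" "\<eta> \<in> ball x r"
    "r / 4 * (r / 4) * ?b \<xi> = r / 4 * (r / 4) * ?a \<eta>"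
  proof -
    have r4: "0 < r / 4" "2 * (r / 4) < r" using r by simp_all
    have swap: "x + (r / 4) *\<^sub>R axis i 1 + (r / 4) *\<^sub>R axis j 1
        = x + (r / 4) *\<^sub>R axis j 1 + (r / 4) *\<^sub>R axis i 1"
      by (simp add: ac_simps)
    obtain \<xi> where xi: "\<xi> \<in> ball x r" "f (x + (r / 4) *\<^sub>R axis i 1 + (r / 4) *\<^sub>R axis j 1)
        - f (x + (r / 4) *\<^sub>R axis i 1) - f (x + (r / 4) *\<^sub>R axis j 1) + f x = r / 4 * (r / 4) * ?b \<xi>"
      using second_difference_mean_value[OF C2 r4, of i j] by blast
    obtain \<eta> where eta: "\<eta> \<in> ball x r" "f (x + (r / 4) *\<^sub>R axis j 1 + (r / 4) *\<^sub>R axis i 1)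
        - f (x + (r / 4) *\<^sub>R axis j 1) - f (x + (r / 4) *\<^sub>R axis i 1) + f x = r / 4 * (r / 4) * ?a \<eta>"
      using second_difference_mean_value[OF C2 r4, of j i] by blast
    show thesis
    proof (rule that[OF xi(1) eta(1)])
      show "r / 4 * (r / 4) * ?b \<xi> = r / 4 * (r / 4) * ?a \<eta>"
        unfolding xi(2)[symmetric] eta(2)[symmetric] swap by simp
    qed
  qed
  then have "?b \<xi> = ?a \<eta>" using r by simp
  moreover have "dist (?a \<eta>) (?a x) < e" "dist (?b \<xi>) (?b x) < e"
    using xe d by (auto simp: r_def dist_commute)
  ultimately show False
    using e unfolding e_def dist_real_def by argo
qed

lemma partial_prod:
  fixes f :: "'b \<Rightarrow> real^'n::finite \<Rightarrow> real"
  assumes "finite A" "\<And>r. r \<in> A \<Longrightarrow> f r differentiable (at x)"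
  shows "(\<lambda>x. \<Prod>r\<in>A. f r x) differentiable (at x) \<and>
    partial i (\<lambda>x. \<Prod>r\<in>A. f r x) x = (\<Sum>r\<in>A. partial i (f r) x * (\<Prod>s\<in>A - {r}. f s x))"
  using assms
proof (induction A rule: finite_induct)
  case (insert a A)
  then have *: "f a differentiable (at x)" "(\<lambda>x. \<Prod>r\<in>A. f r x) differentiable (at x)"
    by auto
  have "(\<Prod>s\<in>insert a A - {r}. f s x) = f a x * (\<Prod>s\<in>A - {r}. f s x)" if "r \<in> A" for r
  proof -
    have "insert a A - {r} = insert a (A - {r})" using that insert by auto
    then show ?thesis using insert by simp
  qed
  then have "(\<Sum>r\<in>A. partial i (f r) x * (\<Prod>s\<in>insert a A - {r}. f s x))
      = f a x * (\<Sum>r\<in>A. partial i (f r) x * (\<Prod>s\<in>A - {r}. f s x))"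
    by (simp add: sum_distrib_left mult.left_commute)
  moreover have "insert a A - {a} = A" using insert by auto
  ultimately show ?case
    using insert * by (simp add: partial_mult[OF *])
qed simp

text \<open>Jacobi's formula. Differentiating the Leibniz expansion gives the sum over all rows of the
determinant in which this row has been differentiated. The differentiated row is a linear combination
of the rows of \<open>M x\<close>, and by Cramer's rule only the coefficient of the replaced row contributes.\<close>

lemma partial_det:
  fixes M :: "real^'m::finite \<Rightarrow> real^'n::finite^'n"
  assumes "\<And>a b. (\<lambda>x. M x $ a $ b) differentiable (at x)" and PM: "P ** M x = mat 1"
  shows "partial i (\<lambda>x. det (M x)) x
    = det (M x) * (\<Sum>a\<in>UNIV. \<Sum>b\<in>UNIV. P $ b $ a * partial i (\<lambda>x. M x $ a $ b) x)"
proof -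
  let ?M' = "\<lambda>a b. partial i (\<lambda>x. M x $ a $ b) x"
  have "partial i (\<lambda>x. det (M x)) x = (\<Sum>p\<in>{p. p permutes UNIV}.
      of_int (sign p) * (\<Sum>a\<in>UNIV. ?M' a (p a) * (\<Prod>b\<in>UNIV - {a}. M x $ b $ p b)))"
  proof -
    have prod: "(\<lambda>x. \<Prod>a\<in>UNIV. M x $ a $ p a) differentiable (at x)"
      "partial i (\<lambda>x. \<Prod>a\<in>UNIV. M x $ a $ p a) x
        = (\<Sum>a\<in>UNIV. ?M' a (p a) * (\<Prod>b\<in>UNIV - {a}. M x $ b $ p b))" for p
      using partial_prod[of "UNIV :: 'n set" "\<lambda>a x. M x $ a $ p a"] assms(1) by auto
    then have "(\<lambda>x. of_int (sign p) * (\<Prod>a\<in>UNIV. M x $ a $ p a)) differentiable (at x)" for p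
      by (intro differentiable_mult) auto
    then show ?thesis
      unfolding det_def by (simp add: partial_sum partial_cmult prod)
  qed
  also have "\<dots> = (\<Sum>a\<in>UNIV. \<Sum>p\<in>{p. p permutes UNIV}.
      of_int (sign p) * (?M' a (p a) * (\<Prod>b\<in>UNIV - {a}. M x $ b $ p b)))"
    unfolding sum_distrib_left by (rule sum.swap)
  also have "\<dots> = (\<Sum>a\<in>UNIV. det (\<chi> b. if b = a then (\<chi> c. ?M' a c) else M x $ b))"
  proof (rule sum.cong[OF refl])
    fix a :: 'n
    have "(\<Prod>b\<in>UNIV. (\<chi> b. if b = a then (\<chi> c. ?M' a c) else M x $ b) $ b $ p b)
        = ?M' a (p a) * (\<Prod>b\<in>UNIV - {a}. M x $ b $ p b)" for p
      by (subst prod.remove[of _ a]) (auto intro!: prod.cong)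
    then show "(\<Sum>p\<in>{p. p permutes UNIV}.
        of_int (sign p) * (?M' a (p a) * (\<Prod>b\<in>UNIV - {a}. M x $ b $ p b)))
      = det (\<chi> b. if b = a then (\<chi> c. ?M' a c) else M x $ b)"
      unfolding det_def by simp
  qed
  also have "\<dots> = (\<Sum>a\<in>UNIV. (\<Sum>b\<in>UNIV. P $ b $ a * ?M' a b) * det (M x))"
  proof (rule sum.cong[OF refl])
    fix a :: 'n
    define y where "y = (\<chi> c. ?M' a c) v* P"
    have "y v* M x = (\<chi> c. ?M' a c)"
      unfolding y_def by (simp add: vector_matrix_mul_assoc PM)
    then have "(\<Sum>b\<in>UNIV. y $ b *s row b (M x)) = (\<chi> c. ?M' a c)"
      by (simp add: vec_eq_iff vector_matrix_mult_def row_def mult.commute)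
    moreover have "y $ a = (\<Sum>b\<in>UNIV. P $ b $ a * ?M' a b)"
      by (simp add: y_def vector_matrix_mult_def mult.commute)
    ultimately show "det (\<chi> b. if b = a then (\<chi> c. ?M' a c) else M x $ b)
        = (\<Sum>b\<in>UNIV. P $ b $ a * ?M' a b) * det (M x)"
      using cramer_lemma_transpose[where x = y and A = "M x" and k = a]
      by (simp add: row_def cong: if_cong)
  qed
  finally show ?thesis
    by (simp add: sum_distrib_left mult.commute flip: sum_distrib_right)
qed

section \<open>Coordinate invariance of operators in divergence form\<close>

text \<open>Where \<open>G\<close> is nonzero, by the product rule this is \<open>1 / sqrt G * (\<Sum>i j. \<partial>\<^sub>i (sqrt G * A i j * \<partial>\<^sub>j F))\<close>: the quotient
\<open>\<partial>\<^sub>i G / (2 * G)\<close> is the logarithmic derivative of \<open>sqrt G\<close>. In this form no square root has to be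
transformed under a change of coordinates.\<close>

definition div_laplace ::
    "('n \<Rightarrow> 'n \<Rightarrow> real^'n \<Rightarrow> real) \<Rightarrow> (real^'n::finite \<Rightarrow> real) \<Rightarrow> (real^'n \<Rightarrow> real) \<Rightarrow> real^'n \<Rightarrow> real"
  where "div_laplace A G F x = (\<Sum>i\<in>UNIV. partial i (\<lambda>z. \<Sum>j\<in>UNIV. A i j z * partial j F z) x
    + (\<Sum>j\<in>UNIV. A i j x * partial j F x) * (partial i G x / (2 * G x)))"

locale coordinate_change =
  fixes S S' :: "(real^'n::finite) set" and T T' :: "real^'n \<Rightarrow> real^'n"
  assumes open_S: "open S" and open_S': "open S'"
    and T_into: "z \<in> S \<Longrightarrow> T z \<in> S'" and T'_into: "y \<in> S' \<Longrightarrow> T' y \<in> S"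
    and T'_T: "z \<in> S \<Longrightarrow> T' (T z) = z" and T_T': "y \<in> S' \<Longrightarrow> T (T' y) = y"
    and C2_T: "Ck_on 2 S (\<lambda>z. T z $ a)" and C2_T': "Ck_on 2 S' (\<lambda>y. T' y $ a)"
begin

definition J :: "'n \<Rightarrow> 'n \<Rightarrow> real^'n \<Rightarrow> real"
  where "J b k z = partial k (\<lambda>z. T z $ b) z"

text \<open>The inverse of the Jacobian \<open>J\<close>. It is taken from the inverse map rather than from a matrix
inverse, which makes its differentiability evident.\<close>

definition P :: "'n \<Rightarrow> 'n \<Rightarrow> real^'n \<Rightarrow> real"
  where "P i a z = partial a (\<lambda>y. T' y $ i) (T z)"

lemma C1_J: "Ck_on 1 S (J b k)"
  using C2_T[of b] by (simp add: J_def[abs_def] numeral_2_eq_2)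

lemma C1_compose: "Ck_on 1 S' f \<Longrightarrow> Ck_on 1 S (\<lambda>z. f (T z))"
  by (rule Ck_on_compose[OF open_S open_S'])
     (use T_into Ck_on_mono[OF C2_T, of 1] in auto)

lemma C1_P: "Ck_on 1 S (P i a)"
  unfolding P_def[abs_def] by (rule C1_compose) (use C2_T'[of i] in \<open>simp add: numeral_2_eq_2\<close>)

lemma diff_T: "z \<in> S \<Longrightarrow> (\<lambda>z. T z $ a) differentiable (at z)"
  by (rule Ck_on_differentiable[OF C2_T _ open_S]) simp_all

lemma diff_T': "y \<in> S' \<Longrightarrow> (\<lambda>y. T' y $ a) differentiable (at y)"
  by (rule Ck_on_differentiable[OF C2_T' _ open_S']) simp_all

lemma C1_diff: "Ck_on 1 S f \<Longrightarrow> z \<in> S \<Longrightarrow> f differentiable (at z)"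
  by (rule Ck_on_differentiable[of 1, OF _ _ open_S]) simp_all

lemma partial_compose_T:
  assumes "z \<in> S" "f differentiable (at (T z))"
  shows "partial i (\<lambda>z. f (T z)) z = (\<Sum>a\<in>UNIV. partial a f (T z) * J a i z)"
  unfolding J_def by (rule partial_chain) (use diff_T assms in auto)

lemma P_J:
  assumes "z \<in> S"
  shows "(\<Sum>a\<in>UNIV. P i a z * J a k z) = (if i = k then 1 else 0)"
proof -
  have "(\<Sum>a\<in>UNIV. P i a z * J a k z) = partial k (\<lambda>z. T' (T z) $ i) z"
    unfolding P_def by (subst partial_compose_T) (use assms T_into diff_T' in auto)
  also have "\<dots> = partial k (\<lambda>z. z $ i) z"
    by (rule partial_cong[OF open_S assms]) (simp add: T'_T)
  finally show ?thesis by (simp add: partial_coordinate)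
qed

lemma J_P:
  assumes "z \<in> S"
  shows "(\<Sum>i\<in>UNIV. J b i z * P i a z) = (if b = a then 1 else 0)"
proof -
  have "(\<chi> i a. P i a z) ** (\<chi> a k. J a k z) = mat 1"
    using P_J[OF assms] by (simp add: matrix_matrix_mult_def mat_def vec_eq_iff)
  then have "(\<chi> a k. J a k z) ** (\<chi> i a. P i a z) = mat 1"
    by (rule matrix_left_right_inverse1)
  then show ?thesis
    by (simp add: matrix_matrix_mult_def mat_def vec_eq_iff)
qed

text \<open>By Jacobi's formula, the logarithmic derivative of the Jacobian determinant.\<close>

definition dlog_det :: "'n \<Rightarrow> real^'n \<Rightarrow> real"
  where "dlog_det i z = (\<Sum>b\<in>UNIV. \<Sum>k\<in>UNIV. P k b z * partial i (J b k) z)"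

text \<open>After multiplication by \<open>det J\<close> this says that each \<open>\<Sum>i. \<partial>\<^sub>i (det J * P i a)\<close> vanishes.
Differentiating \<open>P J = 1\<close> expresses the derivatives of \<open>P\<close> through second derivatives of \<open>T\<close>, and
then both sides differ only in the order of these derivatives.\<close>

lemma piola_identity:
  assumes z: "z \<in> S"
  shows "(\<Sum>i\<in>UNIV. partial i (P i a) z) = - (\<Sum>i\<in>UNIV. P i a z * dlog_det i z)"
proof -
  note D = C1_diff[OF C1_P z] C1_diff[OF C1_J z]
  have dP: "(\<Sum>b\<in>UNIV. partial l (P i b) z * J b k z) = - (\<Sum>b\<in>UNIV. P i b z * partial l (J b k) z)"
    for i k l
  proof -
    have "0 = partial l (\<lambda>z. \<Sum>b\<in>UNIV. P i b z * J b k z) z"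
      by (subst partial_cong[OF open_S z P_J]) auto
    also have "\<dots> = (\<Sum>b\<in>UNIV. partial l (P i b) z * J b k z + P i b z * partial l (J b k) z)"
      by (simp add: partial_sum partial_mult D)
    finally show ?thesis by (simp add: sum.distrib)
  qed
  have "partial l (P i a) z = - (\<Sum>k\<in>UNIV. \<Sum>b\<in>UNIV. P i b z * partial l (J b k) z * P k a z)" for i l
  proof -
    have "partial l (P i a) z = (\<Sum>b\<in>UNIV. partial l (P i b) z * (if b = a then 1 else 0))"
      by (simp add: if_distrib[where f="\<lambda>u. _ * u"] cong: if_cong)
    also have "\<dots> = (\<Sum>b\<in>UNIV. \<Sum>k\<in>UNIV. partial l (P i b) z * (J b k z * P k a z))"
      by (simp only: J_P[OF z, symmetric] sum_distrib_left)
    also have "\<dots> = (\<Sum>k\<in>UNIV. (\<Sum>b\<in>UNIV. partial l (P i b) z * J b k z) * P k a z)"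
      by (subst sum.swap) (simp add: sum_distrib_right mult.assoc)
    finally show ?thesis
      by (simp add: dP sum_distrib_right sum_negf)
  qed
  then have "(\<Sum>i\<in>UNIV. partial i (P i a) z)
      = - (\<Sum>i\<in>UNIV. \<Sum>k\<in>UNIV. \<Sum>b\<in>UNIV. P i b z * partial i (J b k) z * P k a z)"
    by (simp add: sum_negf)
  also have "\<dots> = - (\<Sum>k\<in>UNIV. \<Sum>i\<in>UNIV. \<Sum>b\<in>UNIV. P i b z * partial k (J b i) z * P k a z)"
  proof -
    have "partial i (J b k) z = partial k (J b i) z" for i b k
      unfolding J_def[abs_def] by (rule partial_commute[OF open_S z C2_T])
    then show ?thesis by (subst sum.swap) simp
  qed
  also have "\<dots> = - (\<Sum>k\<in>UNIV. P k a z * dlog_det k z)"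
    unfolding dlog_det_def sum_distrib_left
    by (subst (2) sum.swap) (simp add: ac_simps)
  finally show ?thesis .
qed

text \<open>The gradient field \<open>X = A' \<nabla>F'\<close> corresponds to the field \<open>Y = P (X \<circ> T)\<close> in the other
coordinates. The divergence of \<open>Y\<close> contains derivatives of \<open>P\<close>, which the Piola identity cancels
against the contribution of the factor \<open>(det J)\<^sup>2\<close> of \<open>G\<close>.\<close>

theorem div_laplace_invariant:
  assumes x: "x \<in> S"
    and C2_F: "Ck_on 2 S' F'" and C1_A: "\<And>a b. Ck_on 1 S' (A' a b)" and C1_G: "Ck_on 1 S' G'"
    and G0: "G' (T x) \<noteq> 0"
    and F: "\<And>z. z \<in> S \<Longrightarrow> F z = F' (T z)"
    and A: "\<And>z i j. z \<in> S \<Longrightarrow> A i j z = (\<Sum>a\<in>UNIV. \<Sum>b\<in>UNIV. P i a z * P j b z * A' a b (T z))"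
    and G: "\<And>z. z \<in> S \<Longrightarrow> G z = (det (\<chi> b k. J b k z))\<^sup>2 * G' (T z)"
  shows "div_laplace A G F x = div_laplace A' G' F' (T x)"
proof -
  define X where "X a y = (\<Sum>b\<in>UNIV. A' a b y * partial b F' y)" for a y
  define Y where "Y i z = (\<Sum>j\<in>UNIV. A i j z * partial j F z)" for i z
  have C1_X: "Ck_on 1 S' (X a)" for a
    unfolding X_def[abs_def]
    by (intro Ck_on_sum Ck_on_mult open_S' C1_A) (use C2_F in \<open>auto simp: numeral_2_eq_2\<close>)
  have dF: "F' differentiable (at (T z))" if "z \<in> S" for z
    by (rule Ck_on_differentiable[OF C2_F _ open_S' T_into[OF that]]) simp
  have dS': "f differentiable (at (T z))" if "Ck_on 1 S' f" "z \<in> S" for f :: "real^'n \<Rightarrow> real" and z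
    by (rule Ck_on_differentiable[OF that(1) _ open_S' T_into[OF that(2)]]) simp
  have Y: "Y i z = (\<Sum>a\<in>UNIV. P i a z * X a (T z))" if z: "z \<in> S" for i z
  proof -
    have grad: "(\<Sum>j\<in>UNIV. P j b z * partial j F z) = partial b F' (T z)" for b
    proof -
      have "(\<Sum>j\<in>UNIV. P j b z * partial j F z)
          = (\<Sum>j\<in>UNIV. P j b z * (\<Sum>e\<in>UNIV. partial e F' (T z) * J e j z))"
        by (subst partial_cong[OF open_S z F]) (simp_all add: partial_compose_T[OF z dF[OF z]])
      also have "\<dots> = (\<Sum>e\<in>UNIV. partial e F' (T z) * (\<Sum>j\<in>UNIV. J e j z * P j b z))"
        unfolding sum_distrib_left by (subst sum.swap) (simp add: ac_simps)
      finally show ?thesis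
        by (simp add: J_P[OF z] if_distrib[where f="\<lambda>u. _ * u"] cong: if_cong)
    qed
    have "Y i z = (\<Sum>j\<in>UNIV. \<Sum>a\<in>UNIV. \<Sum>b\<in>UNIV. P i a z * A' a b (T z) * (P j b z * partial j F z))"
      unfolding Y_def A[OF z] sum_distrib_right by (simp add: ac_simps)
    also have "\<dots> = (\<Sum>a\<in>UNIV. \<Sum>b\<in>UNIV. \<Sum>j\<in>UNIV. P i a z * A' a b (T z) * (P j b z * partial j F z))"
      by (subst sum.swap, rule sum.cong[OF refl], rule sum.swap)
    also have "\<dots> = (\<Sum>a\<in>UNIV. P i a z * X a (T z))"
      by (simp add: X_def sum_distrib_left grad flip: mult.assoc)
        (simp add: grad mult.assoc flip: sum_distrib_left)
    finally show ?thesis .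
  qed
  have dY: "partial i (Y i) x = (\<Sum>a\<in>UNIV. partial i (P i a) x * X a (T x)
      + P i a x * (\<Sum>b\<in>UNIV. partial b (X a) (T x) * J b i x))" for i
  proof -
    have "partial i (Y i) x = partial i (\<lambda>z. \<Sum>a\<in>UNIV. P i a z * X a (T z)) x"
      by (rule partial_cong[OF open_S x Y])
    then show ?thesis
      by (simp add: partial_sum partial_mult C1_diff[OF C1_P x] C1_diff[OF C1_compose[OF C1_X] x]
          partial_compose_T[OF x dS'[OF C1_X x]])
  qed
  have sum_dY: "(\<Sum>i\<in>UNIV. partial i (Y i) x)
      = (\<Sum>a\<in>UNIV. X a (T x) * (\<Sum>i\<in>UNIV. partial i (P i a) x)) + (\<Sum>a\<in>UNIV. partial a (X a) (T x))"
  proof -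
    have "(\<Sum>i\<in>UNIV. \<Sum>a\<in>UNIV. P i a x * (\<Sum>b\<in>UNIV. partial b (X a) (T x) * J b i x))
        = (\<Sum>a\<in>UNIV. \<Sum>b\<in>UNIV. partial b (X a) (T x) * (\<Sum>i\<in>UNIV. J b i x * P i a x))"
      unfolding sum_distrib_left
      by (subst sum.swap, rule sum.cong[OF refl], subst sum.swap) (simp add: ac_simps)
    also have "\<dots> = (\<Sum>a\<in>UNIV. partial a (X a) (T x))"
      by (simp add: J_P[OF x] if_distrib[where f="\<lambda>u. _ * u"] cong: if_cong)
    moreover have "(\<Sum>i\<in>UNIV. \<Sum>a\<in>UNIV. partial i (P i a) x * X a (T x))
        = (\<Sum>a\<in>UNIV. X a (T x) * (\<Sum>i\<in>UNIV. partial i (P i a) x))"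
      unfolding sum_distrib_left by (subst sum.swap) (simp add: ac_simps)
    ultimately show ?thesis
      by (simp add: dY sum.distrib)
  qed
  have dG: "partial i G x / (2 * G x)
      = dlog_det i x + (\<Sum>b\<in>UNIV. partial b G' (T x) * J b i x) / (2 * G' (T x))" for i
  proof -
    let ?d = "\<lambda>z. det (\<chi> b k. J b k z)"
    have PJ: "(\<chi> i a. P i a x) ** (\<chi> a k. J a k x) = mat 1"
      using P_J[OF x] by (simp add: matrix_matrix_mult_def mat_def vec_eq_iff)
    have d0: "?d x \<noteq> 0"
      using arg_cong[OF PJ, of det] by (auto simp: det_mul)
    have C1_d: "Ck_on 1 S ?d"
      unfolding det_def by (intro Ck_on_sum Ck_on_mult Ck_on_prod Ck_on_const open_S) (use C1_J in simp)
    have dd: "partial i ?d x = ?d x * dlog_det i x"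
      using partial_det[of "\<lambda>z. \<chi> b k. J b k z" x, OF _ PJ, of i]
      by (simp add: C1_diff[OF C1_J x] dlog_det_def)
    note D = C1_diff[OF C1_d x] C1_diff[OF C1_compose[OF C1_G] x]
    have "partial i G x = partial i (\<lambda>z. ?d z * ?d z * G' (T z)) x"
      by (rule partial_cong[OF open_S x]) (simp add: G power2_eq_square)
    also have "\<dots> = 2 * ?d x * (?d x * dlog_det i x) * G' (T x)
        + ?d x * ?d x * (\<Sum>b\<in>UNIV. partial b G' (T x) * J b i x)"
      using D by (simp add: partial_mult dd partial_compose_T[OF x dS'[OF C1_G x]] algebra_simps)
    finally show ?thesis
      using d0 G0 by (simp add: G[OF x] field_simps power2_eq_square)
  qed
  have sum_YG: "(\<Sum>i\<in>UNIV. Y i x * (partial i G x / (2 * G x)))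
      = (\<Sum>a\<in>UNIV. X a (T x) * (\<Sum>i\<in>UNIV. P i a x * dlog_det i x))
        + (\<Sum>a\<in>UNIV. X a (T x) * (partial a G' (T x) / (2 * G' (T x))))"
  proof -
    have "(\<Sum>i\<in>UNIV. Y i x * dlog_det i x) = (\<Sum>a\<in>UNIV. X a (T x) * (\<Sum>i\<in>UNIV. P i a x * dlog_det i x))"
      unfolding Y[OF x] sum_distrib_left sum_distrib_right by (subst sum.swap) (simp add: ac_simps)
    moreover have "(\<Sum>i\<in>UNIV. Y i x * (\<Sum>b\<in>UNIV. partial b G' (T x) * J b i x))
        = (\<Sum>a\<in>UNIV. X a (T x) * partial a G' (T x))"
    proof -
      have "(\<Sum>i\<in>UNIV. Y i x * (\<Sum>b\<in>UNIV. partial b G' (T x) * J b i x))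
        = (\<Sum>i\<in>UNIV. \<Sum>a\<in>UNIV. \<Sum>b\<in>UNIV. X a (T x) * partial b G' (T x) * (J b i x * P i a x))"
        unfolding Y[OF x] sum_product by (simp add: ac_simps)
      also have "\<dots> = (\<Sum>a\<in>UNIV. \<Sum>b\<in>UNIV. X a (T x) * partial b G' (T x) * (\<Sum>i\<in>UNIV. J b i x * P i a x))"
        unfolding sum_distrib_left by (subst sum.swap, rule sum.cong[OF refl], rule sum.swap)
      finally show ?thesis by (simp add: J_P[OF x] if_distrib[where f="\<lambda>u. _ * u"] cong: if_cong)
    qed
    ultimately show ?thesis
      by (simp add: dG distrib_left sum.distrib flip: sum_divide_distrib)
  qed
  have "div_laplace A G F x = (\<Sum>i\<in>UNIV. partial i (Y i) x) + (\<Sum>i\<in>UNIV. Y i x * (partial i G x / (2 * G x)))"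
    by (simp add: div_laplace_def Y_def[abs_def] sum.distrib)
  also have "\<dots> = (\<Sum>a\<in>UNIV. partial a (X a) (T x))
      + (\<Sum>a\<in>UNIV. X a (T x) * (partial a G' (T x) / (2 * G' (T x))))"
    unfolding sum_dY sum_YG piola_identity[OF x] by (simp add: sum_negf)
  also have "\<dots> = div_laplace A' G' F' (T x)"
    by (simp add: div_laplace_def X_def[abs_def] sum.distrib)
  finally show ?thesis .
qed

end

section \<open>Inverse matrices and smooth functions on a manifold\<close>

lemma matrix_inv_eq:
  fixes A B :: "real^'n::finite^'n"
  assumes "A ** B = mat 1"
  shows "matrix_inv A = B"
proof -
  have BA: "B ** A = mat 1" using assms by (rule matrix_left_right_inverse1)
  then have "\<exists>A'. A ** A' = mat 1 \<and> A' ** A = mat 1" using assms by blast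
  then have "A ** matrix_inv A = mat 1"
    unfolding matrix_inv_def by (rule someI2_ex) simp
  then have "B ** (A ** matrix_inv A) = B" by simp
  then show ?thesis by (simp add: matrix_mul_assoc BA)
qed

lemma matrix_inv_right:
  fixes A :: "real^'n::finite^'n"
  assumes "det A \<noteq> 0"
  shows "A ** matrix_inv A = mat 1"
proof -
  obtain B where "A ** B = mat 1"
    using assms unfolding invertible_det_nz[symmetric] invertible_def by blast
  then show ?thesis using matrix_inv_eq by blast
qed

text \<open>This shows that the entries of the inverse depend smoothly on the matrix.\<close>

lemma matrix_inv_cramer:
  fixes A :: "real^'n::finite^'n"
  assumes "det A \<noteq> 0"
  shows "matrix_inv A $ i $ j
    = det (\<chi> a b. if b = i then (if a = j then 1 else 0) else A $ a $ b) / det A"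
proof -
  have "A *v column j (matrix_inv A) = column j (A ** matrix_inv A)"
    by (simp add: column_def matrix_matrix_mult_def matrix_vector_mult_def vec_eq_iff)
  also have "\<dots> = axis j 1"
    by (simp add: matrix_inv_right[OF assms] column_def mat_def axis_def vec_eq_iff)
  finally have "column j (matrix_inv A)
      = (\<chi> i. det (\<chi> a b. if b = i then axis j 1 $ a else A $ a $ b) / det A)"
    using cramer[OF assms] by blast
  from arg_cong[OF this, of "\<lambda>v. v $ i"] show ?thesis
    by (simp add: column_def axis_def cong: if_cong)
qed

lemma Ck_on_det:
  fixes M :: "real^'m::finite \<Rightarrow> real^'n::finite^'n"
  assumes "open S" "\<And>a b. Ck_on k S (\<lambda>x. M x $ a $ b)"
  shows "Ck_on k S (\<lambda>x. det (M x))"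
  unfolding det_def
  by (intro Ck_on_sum Ck_on_mult Ck_on_prod Ck_on_const assms)

context smooth_manifold
begin

lemma chart_inv_coords: "c \<in> atlas \<Longrightarrow> p \<in> chart_dom c \<Longrightarrow> chart_inv c (coords c p) = p"
  using homeo by (meson homeomorphism_apply1)

lemma coords_chart_inv: "c \<in> atlas \<Longrightarrow> x \<in> chart_im c \<Longrightarrow> coords c (chart_inv c x) = x"
  using homeo by (meson homeomorphism_apply2)

lemma chart_inv_in: "c \<in> atlas \<Longrightarrow> x \<in> chart_im c \<Longrightarrow> chart_inv c x \<in> chart_dom c"
  using homeo by (metis homeomorphism_image2 imageI)

lemma coords_in: "p \<in> chart_dom c \<Longrightarrow> coords c p \<in> chart_im c"
  by (simp add: chart_im_def)

lemma open_coords_image: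
  assumes c: "c \<in> atlas" and "open N"
  shows "open (coords c ` (chart_dom c \<inter> N))"
proof -
  have "coords c ` (chart_dom c \<inter> N) = chart_im c \<inter> chart_inv c -` N"
  proof (intro set_eqI iffI)
    fix x assume "x \<in> chart_im c \<inter> chart_inv c -` N"
    then show "x \<in> coords c ` (chart_dom c \<inter> N)"
      using coords_chart_inv[OF c, of x] chart_inv_in[OF c, of x]
      by (intro image_eqI[of _ _ "chart_inv c x"]) auto
  qed (auto simp: chart_inv_coords[OF c] coords_in)
  moreover have "continuous_on (chart_im c) (chart_inv c)"
    using homeo[OF c] by (simp add: homeomorphism_def)
  ultimately show ?thesis
    using open_im[OF c] assms(2) by (simp add: continuous_on_open_vimage Int_commute)
qed

lemma open_chart_inv_image:
  assumes c: "c \<in> atlas" and "open N" "N \<subseteq> chart_im c"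
  shows "open (chart_inv c ` N)"
proof -
  have "chart_inv c ` N = chart_dom c \<inter> coords c -` N"
  proof (intro set_eqI iffI)
    fix p assume "p \<in> chart_dom c \<inter> coords c -` N"
    then show "p \<in> chart_inv c ` N"
      using chart_inv_coords[OF c, of p] by (intro image_eqI[of _ _ "coords c p"]) auto
  next
    fix p assume "p \<in> chart_inv c ` N"
    then obtain x where "x \<in> N" "x \<in> chart_im c" "p = chart_inv c x"
      using assms(3) by blast
    then show "p \<in> chart_dom c \<inter> coords c -` N"
      by (simp add: coords_chart_inv[OF c] chart_inv_in[OF c])
  qed
  moreover have "continuous_on (chart_dom c) (coords c)"
    using homeo[OF c] by (simp add: homeomorphism_def)
  ultimately show ?thesis
    using open_dom[OF c] assms(2) by (simp add: continuous_on_open_vimage Int_commute)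
qed

lemma transition_coords:
  "c \<in> atlas \<Longrightarrow> p \<in> chart_dom c \<Longrightarrow> transition c d (coords c p) = coords d p"
  by (simp add: transition_def chart_inv_coords)

lemma coordinate_change_transition:
  assumes "c \<in> atlas" "d \<in> atlas"
  shows "coordinate_change (coords c ` (chart_dom c \<inter> chart_dom d)) (coords d ` (chart_dom c \<inter> chart_dom d))
    (transition c d) (transition d c)"
proof
  show "open (coords c ` (chart_dom c \<inter> chart_dom d))" "open (coords d ` (chart_dom c \<inter> chart_dom d))"
    using open_coords_image[OF assms(1) open_dom[OF assms(2)]]
      open_coords_image[OF assms(2) open_dom[OF assms(1)]] by (simp_all add: Int_commute)
  show "Ck_on 2 (coords c ` (chart_dom c \<inter> chart_dom d)) (\<lambda>z. transition c d z $ a)"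
    "Ck_on 2 (coords d ` (chart_dom c \<inter> chart_dom d)) (\<lambda>z. transition d c z $ a)" for a
    using compat[OF assms] compat[OF assms(2,1)] by (simp_all add: Cinf_on_def Int_commute)
qed (auto simp: transition_coords assms)

lemma Ck_on_change_chart:
  assumes "c \<in> atlas" "d \<in> atlas" "Ck_on k (chart_im c) F"
  shows "Ck_on k (coords d ` (chart_dom d \<inter> chart_dom c)) (\<lambda>x. F (transition d c x))"
proof (rule Ck_on_compose)
  show "open (coords d ` (chart_dom d \<inter> chart_dom c))"
    by (rule open_coords_image[OF assms(2) open_dom[OF assms(1)]])
  show "transition d c ` coords d ` (chart_dom d \<inter> chart_dom c) \<subseteq> chart_im c"
    by (auto simp: transition_coords assms coords_in)
  show "Ck_on k (coords d ` (chart_dom d \<inter> chart_dom c)) (\<lambda>x. transition d c x $ a)" for a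
    using compat[OF assms(2,1)] by (simp add: Cinf_on_def)
qed (use assms open_im in auto)

lemma Ck_fun_locally:
  assumes "\<And>p. \<exists>N h. open N \<and> p \<in> N \<and> Ck_fun atlas k h \<and> (\<forall>q\<in>N. f q = h q)"
  shows "Ck_fun atlas k f"
  unfolding Ck_fun_def
proof (intro ballI Ck_on_locally)
  fix c x assume c: "c \<in> atlas" and x: "x \<in> chart_im c"
  obtain N h where N: "open N" "chart_inv c x \<in> N" "Ck_fun atlas k h" "\<And>q. q \<in> N \<Longrightarrow> f q = h q"
    using assms[of "chart_inv c x"] by auto
  let ?N = "coords c ` (chart_dom c \<inter> N)"
  have N_im: "?N \<subseteq> chart_im c" by (auto simp: chart_im_def)
  have op: "open ?N" by (rule open_coords_image[OF c N(1)])
  have "Ck_on k ?N (h \<circ> chart_inv c)"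
    using N(3) c N_im by (auto simp: Ck_fun_def intro: Ck_on_subset)
  then have "Ck_on k ?N (f \<circ> chart_inv c)"
  proof (subst Ck_on_cong[OF op])
    show "(f \<circ> chart_inv c) y = (h \<circ> chart_inv c) y" if "y \<in> ?N" for y
      using that N(4) by (auto simp: chart_inv_coords[OF c])
  qed
  moreover have "x \<in> ?N"
    using N(2) chart_inv_in[OF c x] coords_chart_inv[OF c x] by (metis IntI imageI)
  ultimately show "\<exists>N. open N \<and> x \<in> N \<and> Ck_on k N (f \<circ> chart_inv c)"
    using op by blast
qed

lemma Ck_fun_sum:
  assumes "\<And>j. j \<in> K \<Longrightarrow> Ck_fun atlas k (f j)"
  shows "Ck_fun atlas k (\<lambda>p. \<Sum>j\<in>K. a j * f j p)"
  unfolding Ck_fun_def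
proof
  fix c assume c: "c \<in> atlas"
  have "Ck_on k (chart_im c) (\<lambda>x. \<Sum>j\<in>K. a j * (f j \<circ> chart_inv c) x)"
    using assms c by (intro Ck_on_sum Ck_on_mult Ck_on_const open_im[OF c]) (auto simp: Ck_fun_def comp_def)
  then show "Ck_on k (chart_im c) ((\<lambda>p. \<Sum>j\<in>K. a j * f j p) \<circ> chart_inv c)"
    by (simp add: comp_def)
qed

text \<open>The two pieces overlap in the open set \<open>chart_dom c - K\<close>, where both are zero.\<close>

lemma Ck_fun_extend_by_zero:
  assumes c: "c \<in> atlas" and F: "Ck_on k (chart_im c) F"
    and K: "closed K" "K \<subseteq> chart_dom c"
    and zero: "\<And>p. p \<in> chart_dom c - K \<Longrightarrow> F (coords c p) = 0"
  shows "Ck_fun atlas k (\<lambda>p. if p \<in> chart_dom c then F (coords c p) else 0)"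
    (is "Ck_fun atlas k ?f")
  unfolding Ck_fun_def
proof (intro ballI Ck_on_locally)
  fix d x assume d: "d \<in> atlas" and x: "x \<in> chart_im d"
  let ?p = "chart_inv d x"
  have x_eq: "x = coords d ?p" and p: "?p \<in> chart_dom d"
    using chart_inv_in[OF d x] coords_chart_inv[OF d x] by simp_all
  show "\<exists>N. open N \<and> x \<in> N \<and> Ck_on k N (?f \<circ> chart_inv d)"
  proof (cases "?p \<in> chart_dom c")
    case True
    let ?N = "coords d ` (chart_dom d \<inter> chart_dom c)"
    have op: "open ?N" by (rule open_coords_image[OF d open_dom[OF c]])
    have "Ck_on k ?N (?f \<circ> chart_inv d) = Ck_on k ?N (\<lambda>x. F (transition d c x))"
      by (rule Ck_on_cong[OF op]) (auto simp: chart_inv_coords[OF d] transition_coords[OF d])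
    then show ?thesis
      using Ck_on_change_chart[OF c d F] op x_eq p True by blast
  next
    case False
    let ?N = "coords d ` (chart_dom d \<inter> - K)"
    have op: "open ?N" by (rule open_coords_image[OF d]) (use K in auto)
    have "Ck_on k ?N (?f \<circ> chart_inv d) = Ck_on k ?N (\<lambda>x. 0)"
      by (rule Ck_on_cong[OF op]) (auto simp: chart_inv_coords[OF d] zero)
    then show ?thesis
      using Ck_on_const op x_eq p False K(2) by blast
  qed
qed

lemma continuous_Ck_fun_0:
  assumes "Ck_fun atlas 0 f"
  shows "continuous_on UNIV f"
proof (intro continuous_at_imp_continuous_on ballI)
  fix p
  obtain c where c: "c \<in> atlas" and p: "p \<in> chart_dom c" using cover by blast
  have "continuous_on (chart_im c) (f \<circ> chart_inv c)"
    using assms c by (simp add: Ck_fun_def)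
  moreover have "continuous_on (chart_dom c) (coords c)"
    using homeo[OF c] by (simp add: homeomorphism_def)
  ultimately have "continuous_on (chart_dom c) (\<lambda>p. (f \<circ> chart_inv c) (coords c p))"
    by (rule continuous_on_compose2) (auto simp: chart_im_def)
  then have "continuous_on (chart_dom c) f"
    by (rule continuous_on_eq) (simp add: chart_inv_coords[OF c])
  then show "isCont f p"
    using p open_dom[OF c] by (simp add: continuous_on_eq_continuous_at)
qed

end

section \<open>The Laplace operator in charts\<close>

context riemannian_manifold
begin

text \<open>The function \<open>G\<close> of the coordinate expression of the Laplacian.\<close>

definition gram :: "('a, 'n) chart \<Rightarrow> real^'n \<Rightarrow> real"
  where "gram c x = det (g c (chart_inv c x))"

definition ginv :: "('a, 'n) chart \<Rightarrow> 'n \<Rightarrow> 'n \<Rightarrow> real^'n \<Rightarrow> real"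
  where "ginv c i j x = matrix_inv (g c (chart_inv c x)) $ i $ j"

lemma det_metric_nonzero:
  assumes "c \<in> atlas" "p \<in> chart_dom c"
  shows "det (g c p) \<noteq> 0"
proof -
  have "v = 0" if "g c p *v v = 0" for v
    using metric_pos[OF assms, of v] that by auto
  then show ?thesis
    unfolding invertible_det_nz[symmetric] invertible_left_inverse
    by (simp add: matrix_left_invertible_ker)
qed

lemma gram_nonzero: "c \<in> atlas \<Longrightarrow> x \<in> chart_im c \<Longrightarrow> gram c x \<noteq> 0"
  by (simp add: gram_def det_metric_nonzero chart_inv_in)

lemma Ck_on_gram: "c \<in> atlas \<Longrightarrow> Ck_on k (chart_im c) (gram c)"
  unfolding gram_def[abs_def]
  by (rule Ck_on_det[OF open_im]) (use metric_smooth in \<open>auto simp: Cinf_on_def\<close>)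

lemma Ck_on_ginv:
  assumes c: "c \<in> atlas"
  shows "Ck_on k (chart_im c) (ginv c i j)"
proof -
  let ?M = "\<lambda>x. \<chi> a b. if b = i then (if a = j then 1 else 0) else g c (chart_inv c x) $ a $ b"
  have "Ck_on k (chart_im c) (\<lambda>x. det (?M x) * inverse (gram c x))"
  proof (intro Ck_on_mult Ck_on_inverse Ck_on_det Ck_on_gram open_im c gram_nonzero)
    show "Ck_on k (chart_im c) (\<lambda>x. ?M x $ a $ b)" for a b
      using metric_smooth[OF c] by (cases "b = i"; cases "a = j") (auto simp: Cinf_on_def Ck_on_const)
  qed
  moreover have "ginv c i j x = det (?M x) * inverse (gram c x)" if "x \<in> chart_im c" for x
    using det_metric_nonzero[OF c chart_inv_in[OF c that]]
    by (simp add: ginv_def gram_def matrix_inv_cramer divide_inverse)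
  ultimately show ?thesis
    using Ck_on_cong[OF open_im[OF c], of "ginv c i j" "\<lambda>x. det (?M x) * inverse (gram c x)" k] by simp
qed

lemma laplacian_in_chart_div:
  assumes c: "c \<in> atlas" and p: "p \<in> chart_dom c"
    and C2: "Ck_on 2 (chart_im c) (f \<circ> chart_inv c)"
  shows "laplacian_in_chart g c f p = div_laplace (ginv c) (gram c) (f \<circ> chart_inv c) (coords c p)"
proof -
  let ?F = "f \<circ> chart_inv c" and ?x = "coords c p"
  note op = open_im[OF c] and x = coords_in[OF p]
  have G0: "gram c ?x \<noteq> 0" using gram_nonzero[OF c x] .
  have dG: "gram c differentiable (at ?x)"
    by (rule Ck_on_differentiable[OF Ck_on_gram[OF c, of 1] _ op x]) simp
  have dA: "(\<lambda>x. ginv c i j x * partial j ?F x) differentiable (at ?x)" for i j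
  proof (rule Ck_on_differentiable[OF _ _ op x])
    show "Ck_on 1 (chart_im c) (\<lambda>x. ginv c i j x * partial j ?F x)"
      by (intro Ck_on_mult op Ck_on_ginv c) (use C2 in \<open>auto simp: numeral_2_eq_2\<close>)
  qed simp
  \<comment> \<open>The square root is extended to negative numbers as an odd function, so the logarithmic derivative of \<open>sqrt\<close> at \<open>G\<close> is \<open>1 / (2 * G)\<close> for either sign.\<close>
  obtain e where e: "(sqrt has_real_derivative e) (at (gram c ?x))" "e / sqrt (gram c ?x) = 1 / (2 * gram c ?x)"
  proof (cases "gram c ?x > 0")
    case True
    show thesis
      by (rule that[OF DERIV_real_sqrt_generic[OF G0, of "inverse (sqrt (gram c ?x)) / 2"]])
        (use True in \<open>auto simp: field_simps\<close>)
  next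
    case False
    have "sqrt (gram c ?x) * sqrt (gram c ?x) = - gram c ?x"
      using False real_sqrt_mult_self[of "gram c ?x"] by simp
    then have "- (inverse (sqrt (gram c ?x)) / 2) / sqrt (gram c ?x) = 1 / (2 * gram c ?x)"
      using G0 by (simp add: field_simps)
    then show thesis
      by (intro that[OF DERIV_real_sqrt_generic[OF G0, of "- (inverse (sqrt (gram c ?x)) / 2)"]])
        (use False G0 in auto)
  qed
  have dsqrt: "(\<lambda>x. sqrt (gram c x)) differentiable (at ?x)"
    using has_derivative_compose[of "gram c" _ ?x UNIV sqrt "(*) e"] dG e(1)
    unfolding differentiable_def has_field_derivative_def by blast
  have dprod: "partial i (\<lambda>x. ginv c i j x * sqrt (gram c x) * partial j ?F x) ?x
      = sqrt (gram c ?x) * partial i (\<lambda>x. ginv c i j x * partial j ?F x) ?x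
        + ginv c i j ?x * partial j ?F ?x * (e * partial i (gram c) ?x)" for i j
  proof -
    have "(\<lambda>x. ginv c i j x * sqrt (gram c x) * partial j ?F x)
        = (\<lambda>x. ginv c i j x * partial j ?F x * sqrt (gram c x))"
      by (simp add: ac_simps)
    then show ?thesis
      by (simp only: partial_mult[OF dA dsqrt] partial_chain_real[OF e(1) dG]) simp
  qed
  then have "1 / sqrt (gram c ?x) * partial i (\<lambda>x. ginv c i j x * sqrt (gram c x) * partial j ?F x) ?x
      = partial i (\<lambda>x. ginv c i j x * partial j ?F x) ?x
        + ginv c i j ?x * partial j ?F ?x * (partial i (gram c) ?x / (2 * gram c ?x))" for i j
  proof -
    have "1 / s * (s * u + v * (e * w)) = u + v * (w * (e / s))" if "s \<noteq> 0" for s u v w :: real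
      using that by (simp add: field_simps)
    then show ?thesis
      unfolding dprod using G0
      by (simp add: e(2) del: times_divide_eq_left times_divide_eq_right) simp
  qed
  then have "laplacian_in_chart g c f p = (\<Sum>i\<in>UNIV. \<Sum>j\<in>UNIV.
      partial i (\<lambda>x. ginv c i j x * partial j ?F x) ?x
        + ginv c i j ?x * partial j ?F ?x * (partial i (gram c) ?x / (2 * gram c ?x)))"
    unfolding laplacian_in_chart_def Let_def sum_distrib_left ginv_def gram_def by simp
  then show ?thesis
    unfolding div_laplace_def using dA by (simp add: partial_sum sum.distrib sum_distrib_right sum_divide_distrib)
qed

text \<open>The tensor law says \<open>g c = J\<^sup>T (g d) J\<close> for the Jacobian \<open>J\<close> of the transition map. Its inverse and
its determinant are the transformation laws in \<open>div_laplace_invariant\<close>.\<close>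

lemma laplacian_in_chart_invariant:
  assumes c: "c \<in> atlas" and d: "d \<in> atlas" and p: "p \<in> chart_dom c" "p \<in> chart_dom d"
    and C2: "Ck_fun atlas 2 f"
  shows "laplacian_in_chart g c f p = laplacian_in_chart g d f p"
proof -
  let ?D = "chart_dom c \<inter> chart_dom d"
  interpret T: coordinate_change "coords c ` ?D" "coords d ` ?D" "transition c d" "transition d c"
    by (rule coordinate_change_transition[OF c d])
  have C2_c: "Ck_on 2 (chart_im c) (f \<circ> chart_inv c)" and C2_d: "Ck_on 2 (chart_im d) (f \<circ> chart_inv d)"
    using C2 c d by (auto simp: Ck_fun_def)
  have sub: "coords d ` ?D \<subseteq> chart_im d" by (auto simp: chart_im_def)
  have metric: "g c q = transpose (\<chi> a i. T.J a i (coords c q)) ** g d q ** (\<chi> a i. T.J a i (coords c q))"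
    if "q \<in> ?D" for q
  proof -
    have "g c q $ i $ j = (\<Sum>b\<in>UNIV. (\<Sum>a\<in>UNIV. T.J a i (coords c q) * g d q $ a $ b) * T.J b j (coords c q))"
      for i j
    proof -
      have "g c q $ i $ j = (\<Sum>a\<in>UNIV. \<Sum>b\<in>UNIV.
          T.J a i (coords c q) * T.J b j (coords c q) * g d q $ a $ b)"
        unfolding T.J_def by (rule metric_transform[OF c d that])
      also have "\<dots> = (\<Sum>b\<in>UNIV. \<Sum>a\<in>UNIV.
          T.J a i (coords c q) * T.J b j (coords c q) * g d q $ a $ b)"
        by (rule sum.swap)
      finally show ?thesis unfolding sum_distrib_right by (simp add: ac_simps)
    qed
    then show ?thesis
      by (simp add: vec_eq_iff matrix_matrix_mult_def transpose_def)
  qed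
  have "div_laplace (ginv c) (gram c) (f \<circ> chart_inv c) (coords c p)
      = div_laplace (ginv d) (gram d) (f \<circ> chart_inv d) (transition c d (coords c p))"
  proof (rule T.div_laplace_invariant)
    show "coords c p \<in> coords c ` ?D" using p by blast
    show "Ck_on 2 (coords d ` ?D) (f \<circ> chart_inv d)"
      by (rule Ck_on_subset[OF C2_d sub])
    show "Ck_on 1 (coords d ` ?D) (ginv d a b)" for a b
      by (rule Ck_on_subset[OF Ck_on_ginv[OF d] sub])
    show "Ck_on 1 (coords d ` ?D) (gram d)"
      by (rule Ck_on_subset[OF Ck_on_gram[OF d] sub])
    show "gram d (transition c d (coords c p)) \<noteq> 0"
      using p by (simp add: transition_coords[OF c] gram_nonzero[OF d] coords_in)
  next
    fix z assume "z \<in> coords c ` ?D"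
    then obtain q where q: "q \<in> ?D" "z = coords c q" by blast
    then have inv: "chart_inv c z = q" "chart_inv d (transition c d z) = q"
      by (auto simp: chart_inv_coords transition_coords c d)
    let ?J = "\<chi> a i. T.J a i z" and ?P = "\<chi> i a. T.P i a z"
    have z: "z \<in> coords c ` ?D" using q by blast
    have JP: "?J ** ?P = mat 1"
      using T.J_P[OF z] by (simp add: matrix_matrix_mult_def mat_def vec_eq_iff)
    have PJ': "transpose ?J ** transpose ?P = mat 1"
      using matrix_left_right_inverse1[OF JP] by (simp flip: matrix_transpose_mul)
    have gq: "g c q = transpose ?J ** g d q ** ?J"
      using metric[OF q(1)] q(2) by simp
    show "(f \<circ> chart_inv c) z = (f \<circ> chart_inv d) (transition c d z)"
      by (simp add: inv)
    show "gram c z = (det ?J)\<^sup>2 * gram d (transition c d z)"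
      by (simp add: gram_def inv gq det_mul power2_eq_square)
    have "g c q ** (?P ** matrix_inv (g d q) ** transpose ?P)
        = transpose ?J ** (g d q ** ((?J ** ?P) ** matrix_inv (g d q))) ** transpose ?P"
      unfolding gq by (simp only: matrix_mul_assoc)
    also have "\<dots> = mat 1"
      using matrix_inv_right[of "g d q"] det_metric_nonzero[OF d, of q] q(1) by (simp add: JP PJ')
    finally have "matrix_inv (g c q) = ?P ** matrix_inv (g d q) ** transpose ?P"
      by (rule matrix_inv_eq)
    then have "ginv c i j z = (\<Sum>b\<in>UNIV. \<Sum>a\<in>UNIV. T.P i a z * T.P j b z * ginv d a b (transition c d z))"
      for i j
      unfolding ginv_def inv
      by (simp add: matrix_matrix_mult_def transpose_def sum_distrib_left sum_distrib_right ac_simps)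
    then show "ginv c i j z = (\<Sum>a\<in>UNIV. \<Sum>b\<in>UNIV. T.P i a z * T.P j b z * ginv d a b (transition c d z))"
      for i j
      by (subst sum.swap) simp
  qed
  then show ?thesis
    using laplacian_in_chart_div[OF c p(1) C2_c] laplacian_in_chart_div[OF d p(2) C2_d]
    by (simp add: transition_coords[OF c p(1)])
qed

lemma laplacian_eq_in_chart:
  assumes "c \<in> atlas" "p \<in> chart_dom c" "Ck_fun atlas 2 f"
  shows "laplacian atlas g f p = laplacian_in_chart g c f p"
  unfolding laplacian_def
  by (rule the_equality) (use assms laplacian_in_chart_invariant in blast)+

text \<open>The first-order coefficients of the Laplacian in nondivergence form.\<close>

definition drift :: "('a, 'n) chart \<Rightarrow> 'n \<Rightarrow> real^'n \<Rightarrow> real"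
  where "drift c j x
    = (\<Sum>i\<in>UNIV. partial i (ginv c i j) x + ginv c i j x * partial i (gram c) x / (2 * gram c x))"

lemma continuous_drift:
  assumes c: "c \<in> atlas"
  shows "continuous_on (chart_im c) (drift c j)"
proof -
  have "continuous_on (chart_im c) (partial i (ginv c i j))" "continuous_on (chart_im c) (ginv c i j)"
    "continuous_on (chart_im c) (partial i (gram c))" "continuous_on (chart_im c) (gram c)" for i
    using Ck_on_ginv[OF c, of 1] Ck_on_ginv[OF c, of 0] Ck_on_gram[OF c, of 1] Ck_on_gram[OF c, of 0]
    by auto
  then show ?thesis
    unfolding drift_def[abs_def] using gram_nonzero[OF c] by (intro continuous_intros) auto
qed

text \<open>The nondivergence form, in which the Laplacian is visibly linear, local and continuous.\<close>

lemma laplacian_coordinates: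
  assumes c: "c \<in> atlas" and p: "p \<in> chart_dom c" and C2: "Ck_fun atlas 2 f"
  shows "laplacian atlas g f p =
    (\<Sum>i\<in>UNIV. \<Sum>j\<in>UNIV. ginv c i j (coords c p) * partial i (partial j (f \<circ> chart_inv c)) (coords c p))
    + (\<Sum>j\<in>UNIV. drift c j (coords c p) * partial j (f \<circ> chart_inv c) (coords c p))"
proof -
  let ?F = "f \<circ> chart_inv c" and ?x = "coords c p"
  note op = open_im[OF c] and x = coords_in[OF p]
  have C2_c: "Ck_on 2 (chart_im c) ?F" using C2 c by (auto simp: Ck_fun_def)
  have dA: "ginv c i j differentiable (at ?x)" for i j
    by (rule Ck_on_differentiable[OF Ck_on_ginv[OF c, of 1] _ op x]) simp
  have dF: "partial j ?F differentiable (at ?x)" for j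
    by (rule Ck_on_differentiable[of 1, OF _ _ op x]) (use C2_c in \<open>auto simp: numeral_2_eq_2\<close>)
  have "laplacian atlas g f p = (\<Sum>i\<in>UNIV. \<Sum>j\<in>UNIV.
      ginv c i j ?x * partial i (partial j ?F) ?x
      + (partial i (ginv c i j) ?x + ginv c i j ?x * partial i (gram c) ?x / (2 * gram c ?x)) * partial j ?F ?x)"
    unfolding laplacian_eq_in_chart[OF c p C2] laplacian_in_chart_div[OF c p C2_c] div_laplace_def
    by (simp add: partial_sum partial_mult dA dF sum.distrib sum_distrib_left sum_distrib_right sum_divide_distrib
        algebra_simps)
  also have "\<dots> = (\<Sum>i\<in>UNIV. \<Sum>j\<in>UNIV. ginv c i j ?x * partial i (partial j ?F) ?x)
      + (\<Sum>j\<in>UNIV. drift c j ?x * partial j ?F ?x)"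
    unfolding drift_def sum_distrib_right
    by (simp only: sum.distrib) (subst (2) sum.swap, simp add: sum.distrib)
  finally show ?thesis .
qed

lemma laplacian_cong:
  assumes "open N" "p \<in> N" "\<And>q. q \<in> N \<Longrightarrow> f q = h q" "Ck_fun atlas 2 f" "Ck_fun atlas 2 h"
  shows "laplacian atlas g f p = laplacian atlas g h p"
proof -
  obtain c where c: "c \<in> atlas" and p: "p \<in> chart_dom c" using cover by blast
  let ?N = "coords c ` (chart_dom c \<inter> N)"
  have op: "open ?N" by (rule open_coords_image[OF c assms(1)])
  have x: "coords c p \<in> ?N" using p assms(2) by blast
  have eq: "(f \<circ> chart_inv c) y = (h \<circ> chart_inv c) y" if "y \<in> ?N" for y
    using that assms(3) by (auto simp: chart_inv_coords[OF c])
  have 1: "partial j (f \<circ> chart_inv c) y = partial j (h \<circ> chart_inv c) y" if "y \<in> ?N" for y j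
    by (rule partial_cong[OF op that eq])
  have "partial i (partial j (f \<circ> chart_inv c)) (coords c p)
      = partial i (partial j (h \<circ> chart_inv c)) (coords c p)" for i j
    by (rule partial_cong[OF op x 1])
  then show ?thesis
    using 1[OF x] by (simp add: laplacian_coordinates[OF c p] assms(4,5))
qed

lemma laplacian_sum:
  assumes C2: "\<And>k. k \<in> K \<Longrightarrow> Ck_fun atlas 2 (f k)"
  shows "laplacian atlas g (\<lambda>p. \<Sum>k\<in>K. a k * f k p) p = (\<Sum>k\<in>K. a k * laplacian atlas g (f k) p)"
proof -
  obtain c where c: "c \<in> atlas" and p: "p \<in> chart_dom c" using cover by blast
  let ?x = "coords c p"
  define F where "F k = f k \<circ> chart_inv c" for k
  note op = open_im[OF c] and x = coords_in[OF p]
  have C2_c: "Ck_on 2 (chart_im c) (F k)" if "k \<in> K" for k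
    using C2[OF that] c by (auto simp: Ck_fun_def F_def)
  have dF: "F k differentiable (at y)" if "k \<in> K" "y \<in> chart_im c" for k y
    by (rule Ck_on_differentiable[OF C2_c[OF that(1)] _ op that(2)]) simp
  have dF': "partial j (F k) differentiable (at ?x)" if "k \<in> K" for k j
    by (rule Ck_on_differentiable[of 1, OF _ _ op x]) (use C2_c[OF that] in \<open>auto simp: numeral_2_eq_2\<close>)
  have comp: "(\<lambda>p. \<Sum>k\<in>K. a k * f k p) \<circ> chart_inv c = (\<lambda>x. \<Sum>k\<in>K. a k * F k x)"
    by (simp add: comp_def F_def)
  have 1: "partial j (\<lambda>x. \<Sum>k\<in>K. a k * F k x) y = (\<Sum>k\<in>K. a k * partial j (F k) y)"
    if "y \<in> chart_im c" for j y
    using dF[OF _ that] by (subst partial_sum) (auto intro!: sum.cong partial_cmult)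
  have 2: "partial i (partial j (\<lambda>x. \<Sum>k\<in>K. a k * F k x)) ?x = (\<Sum>k\<in>K. a k * partial i (partial j (F k)) ?x)"
    for i j
  proof -
    have "partial i (partial j (\<lambda>x. \<Sum>k\<in>K. a k * F k x)) ?x
        = partial i (\<lambda>y. \<Sum>k\<in>K. a k * partial j (F k) y) ?x"
      by (rule partial_cong[OF op x 1])
    also have "\<dots> = (\<Sum>k\<in>K. a k * partial i (partial j (F k)) ?x)"
      using dF' by (subst partial_sum) (auto intro!: sum.cong partial_cmult)
    finally show ?thesis .
  qed
  have "(\<Sum>k\<in>K. a k * laplacian atlas g (f k) p)
      = (\<Sum>k\<in>K. \<Sum>i\<in>UNIV. \<Sum>j\<in>UNIV. a k * (ginv c i j ?x * partial i (partial j (F k)) ?x))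
        + (\<Sum>k\<in>K. \<Sum>j\<in>UNIV. a k * (drift c j ?x * partial j (F k) ?x))"
    by (simp add: laplacian_coordinates[OF c p C2, folded F_def] distrib_left sum.distrib sum_distrib_left)
  also have "\<dots> = (\<Sum>i\<in>UNIV. \<Sum>j\<in>UNIV. \<Sum>k\<in>K. a k * (ginv c i j ?x * partial i (partial j (F k)) ?x))
        + (\<Sum>j\<in>UNIV. \<Sum>k\<in>K. a k * (drift c j ?x * partial j (F k) ?x))"
    by (subst sum.swap, subst (2) sum.swap, subst (4) sum.swap) simp
  also have "\<dots> = laplacian atlas g (\<lambda>p. \<Sum>k\<in>K. a k * f k p) p"
  proof -
    have "Ck_fun atlas 2 (\<lambda>p. \<Sum>k\<in>K. a k * f k p)"
      by (rule Ck_fun_sum[OF C2])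
    from laplacian_coordinates[OF c p this] show ?thesis
      unfolding comp 1[OF x] 2 by (simp add: sum_distrib_left ac_simps)
  qed
  finally show ?thesis by simp
qed

lemma continuous_laplacian:
  assumes "Ck_fun atlas 2 f"
  shows "continuous_on UNIV (laplacian atlas g f)"
proof (intro continuous_at_imp_continuous_on ballI)
  fix p
  obtain c where c: "c \<in> atlas" and p: "p \<in> chart_dom c" using cover by blast
  let ?L = "\<lambda>x. (\<Sum>i\<in>UNIV. \<Sum>j\<in>UNIV. ginv c i j x * partial i (partial j (f \<circ> chart_inv c)) x)
    + (\<Sum>j\<in>UNIV. drift c j x * partial j (f \<circ> chart_inv c) x)"
  have C2_c: "Ck_on (Suc (Suc 0)) (chart_im c) (f \<circ> chart_inv c)"
    using assms c by (auto simp: Ck_fun_def numeral_2_eq_2)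
  have "continuous_on (chart_im c) (partial j (f \<circ> chart_inv c))" for j
    using C2_c by (auto intro: differentiable_imp_continuous_on)
  then have "continuous_on (chart_im c) ?L"
    using C2_c Ck_on_ginv[OF c, of 0] continuous_drift[OF c]
    by (intro continuous_intros) auto
  moreover have "continuous_on (chart_dom c) (coords c)"
    using homeo[OF c] by (simp add: homeomorphism_def)
  ultimately have "continuous_on (chart_dom c) (\<lambda>p. ?L (coords c p))"
    by (rule continuous_on_compose2) (auto simp: chart_im_def)
  then have "continuous_on (chart_dom c) (laplacian atlas g f)"
    using laplacian_coordinates[OF c _ assms] by (simp cong: continuous_on_cong)
  then show "isCont (laplacian atlas g f) p"
    using p open_dom[OF c] by (simp add: continuous_on_eq_continuous_at)
qed

end

section \<open>Bumps that are subharmonic off a small core\<close>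

text \<open>Every derivative of \<open>exp (- 1 / t)\<close> is a polynomial in \<open>1 / t\<close> times \<open>exp (- 1 / t)\<close>; the
recursion is the product rule.\<close>

fun cutoff_poly :: "nat \<Rightarrow> real poly" where
  "cutoff_poly 0 = 1"
| "cutoff_poly (Suc m) = [:0, 0, 1:] * (cutoff_poly m - pderiv (cutoff_poly m))"

text \<open>The \<open>m\<close>-th derivative of the flat function that is \<open>exp (- 1 / t)\<close> for positive \<open>t\<close> and zero
otherwise.\<close>

definition cutoff :: "nat \<Rightarrow> real \<Rightarrow> real"
  where "cutoff m t = (if t > 0 then poly (cutoff_poly m) (inverse t) * exp (- inverse t) else 0)"

lemma poly_exp_tendsto_0: "((\<lambda>x::real. poly p x * exp (- x)) \<longlongrightarrow> 0) at_top"
proof -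
  have "((\<lambda>x::real. \<Sum>i\<le>degree p. coeff p i * (x ^ i / exp x)) \<longlongrightarrow> (\<Sum>i\<le>degree p. coeff p i * 0)) at_top"
    by (intro tendsto_intros tendsto_power_div_exp_0)
  moreover have "(\<lambda>x::real. \<Sum>i\<le>degree p. coeff p i * (x ^ i / exp x)) = (\<lambda>x. poly p x * exp (- x))"
    by (simp add: poly_altdef exp_minus field_simps sum_distrib_left sum_divide_distrib)
  ultimately show ?thesis by simp
qed

lemma DERIV_cutoff: "(cutoff m has_real_derivative cutoff (Suc m) t) (at t)"
proof -
  consider "t > 0" | "t < 0" | "t = 0" by linarith
  then show ?thesis
  proof cases
    case 1
    let ?p = "cutoff_poly m"
    have "((\<lambda>t. poly ?p (inverse t) * exp (- inverse t)) has_real_derivative cutoff (Suc m) t) (at t)"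
      using 1 by (auto intro!: derivative_eq_intros DERIV_chain'[of inverse _ _ _ "poly ?p"] poly_DERIV
          simp: cutoff_def power2_eq_square algebra_simps)
    then show ?thesis
      by (rule DERIV_cong_ev[THEN iffD1, rotated -1])
        (use 1 in \<open>auto simp: cutoff_def eventually_nhds intro!: exI[of _ "{0<..}"]\<close>)
  next
    case 2
    have "((\<lambda>t. 0) has_real_derivative cutoff (Suc m) t) (at t)"
      using 2 by (simp add: cutoff_def)
    then show ?thesis
      by (rule DERIV_cong_ev[THEN iffD1, rotated -1])
        (use 2 in \<open>auto simp: cutoff_def eventually_nhds intro!: exI[of _ "{..<0}"]\<close>)
  next
    case 3
    \<comment> \<open>From the right, the difference quotient at zero is again a polynomial in \<open>1 / h\<close> times \<open>exp (- 1 / h)\<close>.\<close>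
    have "((\<lambda>h. cutoff m h / h) \<longlongrightarrow> 0) (at 0)"
    proof (rule filterlim_split_at)
      have "\<forall>\<^sub>F h in at_left 0. cutoff m h / h = 0"
        by (auto simp: eventually_at_left_field cutoff_def intro!: exI[of _ "-1"])
      then show "((\<lambda>h. cutoff m h / h) \<longlongrightarrow> 0) (at_left 0)"
        by (rule tendsto_eventually)
      have "((\<lambda>h. poly (pCons 0 (cutoff_poly m)) (inverse h) * exp (- inverse h)) \<longlongrightarrow> 0) (at_right 0)"
        by (rule filterlim_compose[OF poly_exp_tendsto_0 filterlim_inverse_at_top_right])
      moreover have "\<forall>\<^sub>F h in at_right 0. poly (pCons 0 (cutoff_poly m)) (inverse h) * exp (- inverse h)
          = cutoff m h / h"
        by (auto simp: eventually_at_right_field cutoff_def divide_inverse intro!: exI[of _ 1])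
      ultimately show "((\<lambda>h. cutoff m h / h) \<longlongrightarrow> 0) (at_right 0)"
        by (rule Lim_transform_eventually)
    qed
    then show ?thesis
      using 3 by (simp add: DERIV_def cutoff_def)
  qed
qed

lemma cutoff_nonneg: "cutoff 0 t \<ge> 0" and cutoff_pos: "t > 0 \<Longrightarrow> cutoff 0 t > 0"
  by (simp_all add: cutoff_def)

lemma cutoff_eq_0: "t \<le> 0 \<Longrightarrow> cutoff m t = 0"
  by (simp add: cutoff_def)

lemma cutoff_1: "t > 0 \<Longrightarrow> cutoff 1 t = exp (- inverse t) / t\<^sup>2"
  by (simp add: cutoff_def power2_eq_square divide_inverse)

lemma cutoff_2: "t > 0 \<Longrightarrow> cutoff 2 t = exp (- inverse t) / t ^ 4 * (1 - 2 * t)"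
  by (simp add: cutoff_def numeral_2_eq_2 pderiv_pCons power4_eq_xxxx field_simps)

text \<open>The quotient of the second and first derivatives of the flat function grows like \<open>1 / t\<^sup>2\<close> near zero.
Rescaling the argument by a small \<open>\<epsilon>\<close> moves the whole range up to \<open>R\<close> into this region. The factors
\<open>\<epsilon>\<close> and \<open>\<epsilon>\<^sup>2\<close> are the ones that the chain rule produces.\<close>

lemma cutoff_second_dominates_first:
  assumes "A > 0" "L \<ge> 0" "R > 0"
  shows "\<exists>\<epsilon>>0. \<forall>s. 0 < s \<and> s \<le> R \<longrightarrow>
    0 \<le> \<epsilon> * cutoff 1 (\<epsilon> * s) \<and> \<epsilon> * cutoff 1 (\<epsilon> * s) * L < \<epsilon>\<^sup>2 * cutoff 2 (\<epsilon> * s) * A"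
proof -
  \<comment> \<open>At \<open>t = \<epsilon> * s\<close> the claim reads \<open>\<epsilon> * s\<^sup>2 * L < (1 - 2 * \<epsilon> * s) * A\<close>, which is worst at \<open>s = R\<close>. The summand 1 makes the inequality strict.\<close>
  define \<epsilon> where "\<epsilon> = A / (2 * R * A + R\<^sup>2 * L + 1)"
  have den: "2 * R * A + R\<^sup>2 * L + 1 > 0"
    using assms by (intro add_nonneg_pos add_nonneg_nonneg mult_nonneg_nonneg) auto
  have pos: "\<epsilon> > 0" using assms den by (simp add: \<epsilon>_def)
  have eps: "\<epsilon> * (2 * R * A + R\<^sup>2 * L) < A"
    using den assms by (simp add: \<epsilon>_def field_simps)
  have "0 \<le> \<epsilon> * cutoff 1 (\<epsilon> * s) \<and> \<epsilon> * cutoff 1 (\<epsilon> * s) * L < \<epsilon>\<^sup>2 * cutoff 2 (\<epsilon> * s) * A"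
    if s: "0 < s" "s \<le> R" for s
  proof -
    let ?t = "\<epsilon> * s" and ?E = "exp (- inverse (\<epsilon> * s))"
    have t: "?t > 0" using s pos by simp
    note c1 = cutoff_1[OF t] and c2 = cutoff_2[OF t]
    have "\<epsilon> * (2 * s * A + s\<^sup>2 * L) \<le> \<epsilon> * (2 * R * A + R\<^sup>2 * L)"
      using s assms pos by (intro mult_left_mono add_mono mult_right_mono power_mono) auto
    then have "0 < A - \<epsilon> * (2 * s * A + s\<^sup>2 * L)" using eps by simp
    then have "0 < \<epsilon>\<^sup>2 * ?E / ?t ^ 4 * (A - \<epsilon> * (2 * s * A + s\<^sup>2 * L))"
      using pos t by (intro mult_pos_pos divide_pos_pos) auto
    also have "\<dots> = \<epsilon>\<^sup>2 * cutoff 2 ?t * A - \<epsilon> * cutoff 1 ?t * L"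
      unfolding c1 c2 using pos s
      by (simp add: field_simps power2_eq_square power4_eq_xxxx)
    finally show ?thesis
      using pos by (simp add: c1 del: One_nat_def)
  qed
  then show ?thesis using pos by blast
qed

context riemannian_manifold
begin

lemma ginv_posdef:
  assumes c: "c \<in> atlas" and x: "x \<in> chart_im c" and v: "v \<noteq> 0"
  shows "0 < (\<Sum>i\<in>UNIV. \<Sum>j\<in>UNIV. ginv c i j x * (v $ i * v $ j))"
proof -
  let ?g = "g c (chart_inv c x)"
  define w where "w = matrix_inv ?g *v v"
  have gw: "?g *v w = v"
    using matrix_inv_right[OF det_metric_nonzero[OF c chart_inv_in[OF c x]]]
    by (simp add: w_def matrix_vector_mul_assoc)
  then have "w \<noteq> 0" using v by auto
  then have "0 < w \<bullet> v"
    using metric_pos[OF c chart_inv_in[OF c x], of w] by (simp add: gw)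
  also have "w \<bullet> v = (\<Sum>i\<in>UNIV. \<Sum>j\<in>UNIV. ginv c i j x * (v $ i * v $ j))"
    by (simp add: w_def inner_vec_def matrix_vector_mult_def ginv_def sum_distrib_right sum_distrib_left ac_simps)
  finally show ?thesis .
qed

lemma laplacian_zero: "laplacian atlas g (\<lambda>p. 0) p = 0"
  using laplacian_sum[of "{}"] by simp

text \<open>For \<open>u = R\<^sup>2 - |x - a|\<^sup>2\<close> the gradient is \<open>- 2 (x - a)\<close> and the Hessian is \<open>- 2\<close> times the
identity, so \<open>h (u x)\<close> has a second-order part with the factor \<open>h''\<close> and a lower-order part with the
factor \<open>h'\<close>.\<close>

lemma laplacian_radial:
  fixes c :: "('a, 'n) chart" and a :: "real^'n" and R :: real
  defines "u \<equiv> \<lambda>x. R\<^sup>2 - (\<Sum>i\<in>UNIV. (x $ i - a $ i) * (x $ i - a $ i))"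
  assumes c: "c \<in> atlas" and p: "p \<in> chart_dom c" and C2: "Ck_fun atlas 2 f"
    and f: "\<And>q. q \<in> chart_dom c \<Longrightarrow> f q = h 0 (u (coords c q))"
    and h: "\<And>m t. (h m has_real_derivative h (Suc m) t) (at t)"
    and x: "x = coords c p"
  shows "laplacian atlas g f p
    = h 2 (u x) * (4 * (\<Sum>i\<in>UNIV. \<Sum>j\<in>UNIV. ginv c i j x * ((x - a) $ i * (x - a) $ j)))
      - h 1 (u x) * (2 * (\<Sum>i\<in>UNIV. ginv c i i x) + 2 * (\<Sum>j\<in>UNIV. drift c j x * (x - a) $ j))"
proof -
  note op = open_im[OF c]
  have x_im: "x \<in> chart_im c" using coords_in[OF p] x by simp
  have d_shift: "(\<lambda>x. x $ i - b) differentiable (at y)" for i b and y :: "real^'n"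
    by (intro differentiable_diff bounded_linear_imp_differentiable[OF bounded_linear_vec_nth] differentiable_const)
  have p_shift: "partial j (\<lambda>x. x $ i - b) y = (if j = i then 1 else 0)" for i j b and y :: "real^'n"
    using partial_add[of "\<lambda>x. x $ i" y "\<lambda>x. - b" j]
    by (simp add: partial_coordinate bounded_linear_imp_differentiable bounded_linear_vec_nth)
  have d_sq: "(\<lambda>x. \<Sum>i\<in>UNIV. (x $ i - a $ i) * (x $ i - a $ i)) differentiable (at y)" for y
    by (intro differentiable_sum_real differentiable_mult d_shift)
  have u_eq: "u = (\<lambda>x. R\<^sup>2 + (-1) * (\<Sum>i\<in>UNIV. (x $ i - a $ i) * (x $ i - a $ i)))"
    by (simp add: u_def)
  have du: "u differentiable (at y)" for y
    unfolding u_eq by (intro differentiable_add differentiable_mult d_sq) simp_all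
  have pu: "partial j u y = - 2 * (y $ j - a $ j)" for j y
  proof -
    have "partial j u y = (-1) * partial j (\<lambda>x. \<Sum>i\<in>UNIV. (x $ i - a $ i) * (x $ i - a $ i)) y"
      unfolding u_eq by (simp only: partial_add[OF differentiable_const differentiable_mult[OF differentiable_const d_sq]]
          partial_const partial_cmult[OF d_sq] add_0)
    also have "\<dots> = - 2 * (y $ j - a $ j)"
      by (simp add: partial_sum partial_mult d_shift p_shift sum.distrib
          if_distrib[where f="\<lambda>u. u * _"] if_distrib[where f="\<lambda>u. _ * u"] cong: if_cong)
    finally show ?thesis .
  qed
  have eq: "(f \<circ> chart_inv c) y = h 0 (u y)" if "y \<in> chart_im c" for y
    by (simp add: f chart_inv_in[OF c that] coords_chart_inv[OF c that])
  have 1: "partial j (f \<circ> chart_inv c) y = h 1 (u y) * (- 2 * (y $ j - a $ j))"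
    if "y \<in> chart_im c" for j y
  proof -
    have "partial j (f \<circ> chart_inv c) y = partial j (\<lambda>y. h 0 (u y)) y"
      by (rule partial_cong[OF op that eq])
    also have "\<dots> = h 1 (u y) * (- 2 * (y $ j - a $ j))"
      using partial_chain_real[OF h[of 0] du, of j y] by (simp add: pu)
    finally show ?thesis .
  qed
  have 2: "partial i (partial j (f \<circ> chart_inv c)) x
      = 4 * h 2 (u x) * ((x - a) $ i * (x - a) $ j) - 2 * h 1 (u x) * (if i = j then 1 else 0)" for i j
  proof -
    have dh: "(\<lambda>y. h 1 (u y)) differentiable (at x)"
      using has_derivative_compose[of u _ x UNIV "h 1" "(*) (h (Suc 1) (u x))"] du[of x] h[of 1 "u x"]
      unfolding differentiable_def has_field_derivative_def by blast
    have "partial i (partial j (f \<circ> chart_inv c)) x = partial i (\<lambda>y. (- 2) * (h 1 (u y) * (y $ j - a $ j))) x"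
      by (rule partial_cong[OF op x_im]) (simp add: 1 algebra_simps)
    also have "\<dots> = - 2 * (h 2 (u x) * (- 2 * (x $ i - a $ i)) * (x $ j - a $ j)
        + h 1 (u x) * (if i = j then 1 else 0))"
      unfolding partial_cmult[OF differentiable_mult[OF dh d_shift]] partial_mult[OF dh d_shift]
        p_shift partial_chain_real[OF h[of 1] du] pu
      by (simp add: numeral_2_eq_2)
    finally show ?thesis by (simp add: algebra_simps)
  qed
  show ?thesis
    unfolding laplacian_coordinates[OF c p C2] x[symmetric] 1[OF x_im] 2
    by (simp add: right_diff_distrib sum_subtractf sum_distrib_left sum.distrib algebra_simps
        if_distrib[where f="\<lambda>u. _ * u"] sum_negf cong: if_cong)
qed

text \<open>The bump is \<open>h (R\<^sup>2 - |x - a|\<^sup>2)\<close> with a rescaled flat function \<open>h\<close>. Off the core \<open>D\<close> the gradient of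
\<open>R\<^sup>2 - |x - a|\<^sup>2\<close> is bounded away from zero, so the part of the Laplacian with \<open>h''\<close> is at least
\<open>A * h''\<close> with \<open>A > 0\<close>, and it dominates the part with \<open>h'\<close>, which is at most \<open>\<Lambda> * h'\<close>. At the centre
the gradient vanishes, and this is where subharmonicity is lost.\<close>

lemma bump_subharmonic_off_core:
  assumes c: "c \<in> atlas" and q: "q \<in> chart_dom c" and R: "R > 0"
    and ball: "cball (coords c q) R \<subseteq> chart_im c" and D: "open D" "q \<in> D"
  shows "\<exists>\<alpha>. Cinf_fun atlas \<alpha> \<and> (\<forall>p. \<alpha> p \<ge> 0)
    \<and> (\<forall>p. p \<notin> chart_inv c ` cball (coords c q) R \<longrightarrow> \<alpha> p = 0)
    \<and> (\<forall>p\<in>chart_inv c ` ball (coords c q) R. \<alpha> p > 0)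
    \<and> (\<forall>p\<in>chart_inv c ` ball (coords c q) R - D. laplacian atlas g \<alpha> p > 0)
    \<and> (\<forall>p. p \<notin> D \<longrightarrow> laplacian atlas g \<alpha> p \<ge> 0)"
proof -
  define a where "a = coords c q"
  define K where "K = chart_inv c ` cball a R"
  note op = open_im[OF c]
  have cont_inv: "continuous_on (chart_im c) (chart_inv c)"
    using homeo[OF c] by (simp add: homeomorphism_def)
  have ball': "cball a R \<subseteq> chart_im c" using ball by (simp add: a_def)
  have closed_K: "closed K"
    unfolding K_def
    by (intro compact_imp_closed compact_continuous_image continuous_on_subset[OF cont_inv] ball' compact_cball)
  have K_dom: "K \<subseteq> chart_dom c"
    unfolding K_def using chart_inv_in[OF c] ball' by blast
  have in_K: "p \<in> K \<longleftrightarrow> coords c p \<in> cball a R" if "p \<in> chart_dom c" for p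
  proof
    assume "p \<in> K"
    then show "coords c p \<in> cball a R"
      unfolding K_def using ball' coords_chart_inv[OF c] by force
  next
    assume "coords c p \<in> cball a R"
    then show "p \<in> K"
      unfolding K_def using chart_inv_coords[OF c that] by (metis imageI)
  qed
  obtain \<delta> where \<delta>: "\<delta> > 0" "ball a \<delta> \<subseteq> coords c ` (chart_dom c \<inter> D)"
    using open_coords_image[OF c D(1)] q D(2) open_contains_ball unfolding a_def by blast
  define Q where "Q x = 4 * (\<Sum>i\<in>UNIV. \<Sum>j\<in>UNIV. ginv c i j x * ((x - a) $ i * (x - a) $ j))" for x
  define L where "L x = 2 * (\<Sum>i\<in>UNIV. ginv c i i x) + 2 * (\<Sum>j\<in>UNIV. drift c j x * (x - a) $ j)" for x
  have cont_ginv: "continuous_on (chart_im c) (ginv c i j)" for i j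
    using Ck_on_ginv[OF c, of 0] by simp
  have cont_Q: "continuous_on (chart_im c) Q" and cont_L: "continuous_on (chart_im c) L"
    unfolding Q_def[abs_def] L_def[abs_def]
    by (intro continuous_intros cont_ginv continuous_drift[OF c])+
  obtain A where A: "A > 0" "\<And>x. x \<in> cball a R - ball a \<delta> \<Longrightarrow> A \<le> Q x"
  proof (cases "cball a R - ball a \<delta> = {}")
    case False
    have "compact (cball a R - ball a \<delta>)" by (intro compact_diff) auto
    moreover have "continuous_on (cball a R - ball a \<delta>) Q"
      by (rule continuous_on_subset[OF cont_Q]) (use ball' in blast)
    ultimately obtain y where y: "y \<in> cball a R - ball a \<delta>" "\<And>x. x \<in> cball a R - ball a \<delta> \<Longrightarrow> Q y \<le> Q x"
      using continuous_attains_inf[OF _ False] by blast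
    have "y - a \<noteq> 0" using y(1) \<delta>(1) by auto
    then have "Q y > 0"
      using ginv_posdef[OF c, of y "y - a"] y(1) ball' unfolding Q_def by auto
    then show thesis using y(2) that by blast
  next
    case True
    show thesis by (rule that[of 1]) (use True in auto)
  qed
  obtain \<Lambda> where \<Lambda>: "\<Lambda> \<ge> 0" "\<And>x. x \<in> cball a R \<Longrightarrow> L x \<le> \<Lambda>"
  proof -
    have "bounded (L ` cball a R)"
      by (intro compact_imp_bounded compact_continuous_image continuous_on_subset[OF cont_L] ball' compact_cball)
    then obtain B where B: "\<And>x. x \<in> cball a R \<Longrightarrow> norm (L x) \<le> B"
      unfolding bounded_iff by blast
    show thesis
      by (rule that[of "\<bar>B\<bar>"]) (use B in force)+
  qed
  obtain \<epsilon> where \<epsilon>: "\<epsilon> > 0" "\<And>s. 0 < s \<Longrightarrow> s \<le> R\<^sup>2 \<Longrightarrow> 0 \<le> \<epsilon> * cutoff 1 (\<epsilon> * s)"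
    "\<And>s. 0 < s \<Longrightarrow> s \<le> R\<^sup>2 \<Longrightarrow> \<epsilon> * cutoff 1 (\<epsilon> * s) * \<Lambda> < \<epsilon>\<^sup>2 * cutoff 2 (\<epsilon> * s) * A"
    using cutoff_second_dominates_first[OF A(1) \<Lambda>(1), of "R\<^sup>2"] R by auto
  define h where "h m t = \<epsilon> ^ m * cutoff m (\<epsilon> * t)" for m t
  have h: "(h m has_real_derivative h (Suc m) t) (at t)" for m t
  proof -
    have "((\<lambda>t. \<epsilon> * t) has_real_derivative \<epsilon>) (at t)"
      by (auto intro!: derivative_eq_intros)
    from DERIV_cmult[OF DERIV_chain2[OF DERIV_cutoff this], of "\<epsilon> ^ m" m] show ?thesis
      by (simp add: h_def[abs_def] ac_simps)
  qed
  define u where "u x = R\<^sup>2 - (\<Sum>i\<in>UNIV. (x $ i - a $ i) * (x $ i - a $ i))" for x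
  have u_dist: "u x = R\<^sup>2 - (dist a x)\<^sup>2" for x
    by (simp add: u_def dist_norm norm_minus_commute[of a] power2_norm_eq_inner inner_vec_def)
  have u_pos: "u x > 0 \<longleftrightarrow> x \<in> ball a R" and u_le: "u x \<le> R\<^sup>2" for x
    using R by (auto simp: u_dist abs_square_less_1 power_strict_mono intro: power2_less_imp_less)
  define \<alpha> where "\<alpha> p = (if p \<in> chart_dom c then h 0 (u (coords c p)) else 0)" for p
  have smooth: "Ck_fun atlas k \<alpha>" for k
    unfolding \<alpha>_def[abs_def]
  proof (rule Ck_fun_extend_by_zero[OF c _ closed_K K_dom])
    have "Ck_on k (chart_im c) (\<lambda>x. R\<^sup>2 + (-1) * (\<Sum>i\<in>UNIV. (x $ i + (- a $ i)) * (x $ i + (- a $ i))))"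
      by (intro Ck_on_add Ck_on_mult Ck_on_sum Ck_on_const Ck_on_coordinate op)
    then have "Ck_on k (chart_im c) u"
      unfolding u_def[abs_def] by simp
    then show "Ck_on k (chart_im c) (\<lambda>x. h 0 (u x))"
      by (rule Ck_on_compose_real[OF op]) (rule h)
    show "h 0 (u (coords c p)) = 0" if "p \<in> chart_dom c - K" for p
      using that in_K[of p] u_pos[of "coords c p"] \<epsilon>(1)
      by (auto simp: h_def cutoff_eq_0 mult_nonneg_nonpos not_less)
  qed
  have lap: "laplacian atlas g \<alpha> p = h 2 (u (coords c p)) * Q (coords c p) - h 1 (u (coords c p)) * L (coords c p)"
    if "p \<in> chart_dom c" for p
    using laplacian_radial[OF c that smooth, where h = h and a = a and R = R] h
    unfolding Q_def L_def u_def by (simp add: \<alpha>_def u_def)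
  have image_ball: "p \<in> chart_dom c \<and> coords c p \<in> ball a R" if p: "p \<in> chart_inv c ` ball a R" for p
  proof -
    obtain x where x: "x \<in> ball a R" "p = chart_inv c x" using p by blast
    then have "x \<in> chart_im c" using ball' by auto
    then show ?thesis using x chart_inv_in[OF c] coords_chart_inv[OF c] by simp
  qed
  have lap_pos: "laplacian atlas g \<alpha> p > 0" if p: "p \<in> chart_dom c" "coords c p \<in> ball a R" "p \<notin> D" for p
  proof -
    let ?x = "coords c p"
    have "?x \<notin> ball a \<delta>"
    proof
      assume "?x \<in> ball a \<delta>"
      then obtain p' where "p' \<in> chart_dom c" "p' \<in> D" "?x = coords c p'" using \<delta>(2) by blast
      then have "p = p'" using chart_inv_coords[OF c] p(1) by metis
      then show False using \<open>p' \<in> D\<close> p(3) by simp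
    qed
    then have AQ: "A \<le> Q ?x" and LL: "L ?x \<le> \<Lambda>"
      using A(2)[of ?x] \<Lambda>(2)[of ?x] p(2) by auto
    have s: "0 < u ?x" "u ?x \<le> R\<^sup>2" using u_pos u_le p(2) by auto
    have h1: "0 \<le> h 1 (u ?x)" and h12: "h 1 (u ?x) * \<Lambda> < h 2 (u ?x) * A"
      using \<epsilon>(2,3)[OF s] by (simp_all add: h_def)
    have "0 \<le> h 2 (u ?x) * A" using h1 h12 \<Lambda>(1) mult_nonneg_nonneg[of "h 1 (u ?x)" \<Lambda>] by linarith
    then have h2: "0 \<le> h 2 (u ?x)" using A(1) by (simp add: zero_le_mult_iff)
    have "h 1 (u ?x) * L ?x \<le> h 1 (u ?x) * \<Lambda>" "h 2 (u ?x) * A \<le> h 2 (u ?x) * Q ?x"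
      using h1 h2 AQ LL by (simp_all add: mult_left_mono)
    then show ?thesis using h12 by (simp add: lap[OF p(1)])
  qed
  have lap_nonneg: "laplacian atlas g \<alpha> p \<ge> 0" if "p \<notin> D" for p
  proof (cases "p \<in> K")
    case True
    then have p: "p \<in> chart_dom c" using K_dom by blast
    show ?thesis
    proof (cases "coords c p \<in> ball a R")
      case False
      then have "u (coords c p) \<le> 0" using u_pos[of "coords c p"] by linarith
      then have "h m (u (coords c p)) = 0" for m
        using \<epsilon>(1) by (simp add: h_def cutoff_eq_0 mult_nonneg_nonpos)
      then show ?thesis by (simp add: lap[OF p])
    qed (use lap_pos p that in force)
  next
    case False
    have z: "\<alpha> p' = 0" if "p' \<in> - K" for p'
      using that in_K[of p'] u_pos[of "coords c p'"] \<epsilon>(1)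
      by (auto simp: \<alpha>_def h_def cutoff_eq_0 mult_nonneg_nonpos not_less)
    have "laplacian atlas g \<alpha> p = laplacian atlas g (\<lambda>p. 0) p"
      by (rule laplacian_cong[of "- K"])
        (use False closed_K z smooth Ck_fun_sum[of "{}" 2] in auto)
    then show ?thesis by (simp add: laplacian_zero)
  qed
  show ?thesis
    unfolding a_def[symmetric]
  proof (intro exI[of _ \<alpha>] conjI allI ballI impI)
    show "Cinf_fun atlas \<alpha>" using smooth by (simp add: Cinf_fun_def)
    show "\<alpha> p \<ge> 0" for p by (simp add: \<alpha>_def h_def cutoff_nonneg)
    show "\<alpha> p = 0" if "p \<notin> chart_inv c ` cball a R" for p
      using that in_K[of p] u_pos[of "coords c p"] \<epsilon>(1)
      by (auto simp: \<alpha>_def h_def cutoff_eq_0 mult_nonneg_nonpos not_less K_def)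
    show "\<alpha> p > 0" if "p \<in> chart_inv c ` ball a R" for p
      using image_ball[OF that] u_pos[of "coords c p"] \<epsilon>(1) by (simp add: \<alpha>_def h_def cutoff_pos)
    show "laplacian atlas g \<alpha> p > 0" if "p \<in> chart_inv c ` ball a R - D" for p
      using image_ball lap_pos that by blast
    show "laplacian atlas g \<alpha> p \<ge> 0" if "p \<notin> D" for p
      by (rule lap_nonneg[OF that])
  qed
qed

end

section \<open>Well-founded successors in infinite graphs\<close>

locale infinite_graph =
  fixes E :: "nat \<Rightarrow> nat \<Rightarrow> bool"
  assumes sym: "E i j \<Longrightarrow> E j i"
    and locally_finite: "finite {j. E i j}"
    and connected: "S \<noteq> {} \<Longrightarrow> (\<And>i j. i \<in> S \<Longrightarrow> E i j \<Longrightarrow> j \<in> S) \<Longrightarrow> S = UNIV"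
begin

definition above :: "nat \<Rightarrow> (nat \<times> nat) set"
  where "above n = {(i, j). E i j \<and> n \<le> i \<and> n \<le> j}"

definition component :: "nat \<Rightarrow> nat \<Rightarrow> nat set"
  where "component n i = (above n)\<^sup>* `` {i}"

text \<open>By Koenig's lemma, the vertices from which one can walk to infinity at indices at least \<open>n\<close>.\<close>

definition escaping :: "nat \<Rightarrow> nat set"
  where "escaping n = {i. n \<le> i \<and> infinite (component n i)}"

lemma self_in_component: "i \<in> component n i"
  by (simp add: component_def)

lemma component_ge: "j \<in> component n i \<Longrightarrow> n \<le> i \<Longrightarrow> n \<le> j"
  unfolding component_def Image_singleton_iff
  by (induction rule: rtrancl_induct) (auto simp: above_def)

lemma component_eq:
  assumes "j \<in> component n i"
  shows "component n j = component n i"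
proof -
  have "sym ((above n)\<^sup>*)"
    by (rule sym_rtrancl) (auto simp: above_def Relation.sym_def dest: sym)
  moreover have "(i, j) \<in> (above n)\<^sup>*" using assms by (simp add: component_def)
  ultimately have "(j, i) \<in> (above n)\<^sup>*" by (rule symD)
  then show ?thesis
    using \<open>(i, j) \<in> (above n)\<^sup>*\<close> unfolding component_def by (auto intro: rtrancl_trans)
qed

text \<open>A finite component of the graph on \<open>{n..}\<close> has, by connectedness, a vertex adjacent to one of the
vertices below \<open>n\<close>. Only finitely many vertices are, so there are finitely many such components.\<close>

lemma finite_not_escaping: "finite (- escaping n)"
proof -
  define B where "B = (\<Union>k<n. {j. E k j})"
  have "finite B" unfolding B_def using locally_finite by blast
  have "i \<in> {..<n} \<union> (\<Union>j\<in>{j \<in> B. finite (component n j)}. component n j)" if "i \<notin> escaping n" for i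
  proof (cases "i < n")
    case False
    then have fin: "finite (component n i)" using that by (simp add: escaping_def)
    have "\<exists>j\<in>component n i. \<exists>k. E j k \<and> k \<notin> component n i"
    proof (rule ccontr)
      assume "\<not> ?thesis"
      then have "component n i = UNIV"
        using connected[of "component n i"] self_in_component[of i n] by blast
      then show False using fin by simp
    qed
    then obtain j k where jk: "j \<in> component n i" "E j k" "k \<notin> component n i" by blast
    have "k < n"
    proof (rule ccontr)
      assume "\<not> k < n"
      then have "(j, k) \<in> above n"
        using jk component_ge[OF jk(1)] False by (simp add: above_def)
      then show False
        using jk(1,3) unfolding component_def Image_singleton_iff by (meson rtrancl.rtrancl_into_rtrancl)
    qed
    then have "j \<in> B" unfolding B_def using jk(2) sym by blast
    moreover have "i \<in> component n j" "finite (component n j)"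
      using component_eq[OF jk(1)] fin self_in_component[of i n] by simp_all
    ultimately show ?thesis by blast
  qed simp
  then have "- escaping n \<subseteq> {..<n} \<union> (\<Union>j\<in>{j \<in> B. finite (component n j)}. component n j)"
    by blast
  then show ?thesis
    using \<open>finite B\<close> by (auto intro: finite_subset)
qed

lemma escaping_0: "escaping 0 = UNIV"
proof -
  have "component 0 i = UNIV" for i
    by (rule connected) (auto simp: component_def above_def intro: rtrancl_into_rtrancl)
  then show ?thesis by (simp add: escaping_def)
qed

definition level :: "nat \<Rightarrow> nat"
  where "level i = Max {n. i \<in> escaping n}"

lemma finite_levels: "finite {n. i \<in> escaping n}"
  by (rule finite_subset[of _ "{..i}"]) (auto simp: escaping_def)

lemma escaping_level: "i \<in> escaping (level i)"
  using Max_in[OF finite_levels, of i] escaping_0 unfolding level_def by blast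

lemma le_level: "i \<in> escaping n \<Longrightarrow> n \<le> level i"
  unfolding level_def by (rule Max_ge[OF finite_levels]) simp

lemma finite_level_le: "finite {i. level i \<le> n}"
  by (rule finite_subset[OF _ finite_not_escaping[of "Suc n"]]) (use le_level in fastforce)

lemma level_ge_in_component:
  assumes "j \<in> component (level i) i"
  shows "level i \<le> level j"
  using escaping_level[of i] component_eq[OF assms] component_ge[OF assms]
  by (intro le_level) (simp add: escaping_def)

definition climb :: "nat \<Rightarrow> nat \<Rightarrow> bool"
  where "climb i m \<longleftrightarrow> (\<exists>y. (i, y) \<in> above (level i) ^^ m \<and> level i < level y)"

lemma ex_climb: "\<exists>m. climb i m"
proof -
  have "infinite (component (level i) i)"
    using escaping_level[of i] by (simp add: escaping_def)
  then have "\<not> component (level i) i \<subseteq> {j. level j \<le> level i}"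
    using finite_subset[OF _ finite_level_le] by blast
  then obtain y where "y \<in> component (level i) i" "\<not> level y \<le> level i"
    by blast
  then have "y \<in> component (level i) i" "level i < level y"
    by simp_all
  then show ?thesis
    unfolding climb_def component_def Image_singleton_iff rtrancl_power by blast
qed

text \<open>The length of a shortest path from \<open>i\<close> to a vertex of higher level that stays at indices at least
\<open>level i\<close>.\<close>

definition climb_time :: "nat \<Rightarrow> nat"
  where "climb_time i = (LEAST m. climb i m)"

lemma ex_next:
  "\<exists>z. E i z \<and> (level i < level z \<or> level i = level z \<and> climb_time z < climb_time i)"
proof -
  have "climb i (climb_time i)" unfolding climb_time_def by (rule LeastI_ex[OF ex_climb])
  then obtain y where y: "(i, y) \<in> above (level i) ^^ climb_time i" "level i < level y"
    by (auto simp: climb_def)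
  then obtain m where m: "climb_time i = Suc m" by (cases "climb_time i") auto
  obtain z where z: "(i, z) \<in> above (level i)" "(z, y) \<in> above (level i) ^^ m"
    using y(1) unfolding m by (meson relpow_Suc_D2)
  have Ez: "E i z" using z(1) by (simp add: above_def)
  have "z \<in> component (level i) i" using z(1) by (auto simp: component_def)
  then have le: "level i \<le> level z" by (rule level_ge_in_component)
  show ?thesis
  proof (cases "level i = level z")
    case True
    then have "climb z m" using z(2) y(2) by (auto simp: climb_def)
    then have "climb_time z \<le> m" unfolding climb_time_def by (rule Least_le)
    then show ?thesis using True Ez m by auto
  qed (use le Ez in auto)
qed

text \<open>Let \<open>s i\<close> be the first vertex on a shortest path from \<open>i\<close> to a higher level. Passing from \<open>i\<close> to
\<open>s i\<close>, the level rises, or it stays the same and the climbing time drops. Hence, going backwards, the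
level drops or the climbing time rises; since a level has finitely many vertices, its climbing
times are bounded, and no backward chain is infinite. Merely following a path to infinity from
every vertex would not suffice: on the integers with adjacent neighbours, \<open>i \<mapsto> i + 1\<close> has infinite
backward chains.\<close>

theorem ex_wf_successor: "\<exists>s. (\<forall>i. E i (s i)) \<and> wf {(i, s i) | i. True}"
proof -
  obtain s where s: "\<And>i. E i (s i)"
    "\<And>i. level i < level (s i) \<or> level i = level (s i) \<and> climb_time (s i) < climb_time i"
    using ex_next by metis
  \<comment> \<open>Subtracting the climbing time from a bound for its level makes it decrease backwards.\<close>
  define T where "T l = Max (climb_time ` {i. level i \<le> l})" for l
  have T: "climb_time i \<le> T (level i)" for i
    unfolding T_def using finite_level_le by (intro Max_ge) auto
  have "{(i, s i) | i. True} \<subseteq> measures [level, \<lambda>i. T (level i) - climb_time i]"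
  proof clarify
    fix i
    show "(i, s i) \<in> measures [level, \<lambda>i. T (level i) - climb_time i]"
      using s(2)[of i] T[of i] by auto
  qed
  then have "wf {(i, s i) | i. True}"
    by (rule wf_subset[OF wf_measures])
  then show ?thesis using s(1) by blast
qed

end

section \<open>Locally finite covers by coordinate balls\<close>

text \<open>The compact shells \<open>C \<inter> (K (n + 2) - interior (K (n + 1)))\<close> are covered one at a time by finitely
many sets inside \<open>interior (K (n + 3)) - K n\<close>. A compact set lies in some \<open>K b\<close> and therefore misses
all sets chosen for the shells with \<open>n \<ge> b\<close>. The exhaustion starts with two empty sets so that the
shells exhaust \<open>C\<close>.\<close>

lemma locally_finite_cover:
  fixes K :: "nat \<Rightarrow> 'a::t2_space set" and V W :: "'x \<Rightarrow> 'a set"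
  assumes K: "\<And>n. compact (K n)" "\<And>n. K n \<subseteq> interior (K (Suc n))" "(\<Union>n. K n) = UNIV" "K 0 = {}" "K 1 = {}"
    and C: "closed C" "C \<subseteq> U" and U: "open U"
    and good: "\<And>X. X \<in> \<G> \<Longrightarrow> open (V X)"
    and small: "\<And>p N. p \<in> N \<Longrightarrow> open N \<Longrightarrow> \<exists>X\<in>\<G>. p \<in> V X \<and> W X \<subseteq> N"
  shows "\<exists>\<X>\<subseteq>\<G>. countable \<X> \<and> (\<forall>X\<in>\<X>. W X \<subseteq> U \<and> V X \<inter> C \<noteq> {}) \<and> C \<subseteq> (\<Union>X\<in>\<X>. V X)
    \<and> (\<forall>A. compact A \<longrightarrow> finite {X \<in> \<X>. W X \<inter> A \<noteq> {}})"
proof -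
  have K_mono: "K m \<subseteq> K n" if "m \<le> n" for m n
    by (rule lift_Suc_mono_le[of K, OF _ that]) (use K(2) interior_subset in blast)
  define A where "A n = C \<inter> (K (n + 2) - interior (K (n + 1)))" for n
  define O' where "O' n = U \<inter> interior (K (n + 3)) - K n" for n
  have "compact (A n)" for n
    unfolding A_def using C(1) K(1) by (intro closed_Int_compact compact_diff) auto
  have A_O: "A n \<subseteq> O' n" for n
  proof -
    have "K (n + 2) \<subseteq> interior (K (n + 3))" "K n \<subseteq> interior (K (n + 1))"
      using K(2)[of "n + 2"] K(2)[of n] by (simp_all add: eval_nat_numeral)
    then show ?thesis unfolding A_def O'_def using C(2) by blast
  qed
  have open_O: "open (O' n)" for n
    unfolding O'_def using U K(1) by (intro open_Diff open_Int compact_imp_closed) auto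
  have "\<exists>F. finite F \<and> F \<subseteq> {X \<in> \<G>. W X \<subseteq> O' n \<and> V X \<inter> C \<noteq> {}} \<and> A n \<subseteq> (\<Union>X\<in>F. V X)" for n
  proof -
    let ?G = "{X \<in> \<G>. W X \<subseteq> O' n \<and> V X \<inter> C \<noteq> {}}"
    have "A n \<subseteq> (\<Union>X\<in>?G. V X)"
    proof
      fix p assume p: "p \<in> A n"
      then obtain X where "X \<in> \<G>" "p \<in> V X" "W X \<subseteq> O' n"
        using small[OF _ open_O, of p n] A_O by blast
      then show "p \<in> (\<Union>X\<in>?G. V X)" using p by (auto simp: A_def)
    qed
    then obtain F where "F \<subseteq> ?G" "finite F" "A n \<subseteq> (\<Union>X\<in>F. V X)"
      using compactE_image[OF \<open>compact (A n)\<close>, of ?G V] good by (metis (no_types, lifting) mem_Collect_eq)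
    then show ?thesis by blast
  qed
  then have "\<exists>F. \<forall>n. finite (F n) \<and> F n \<subseteq> {X \<in> \<G>. W X \<subseteq> O' n \<and> V X \<inter> C \<noteq> {}}
      \<and> A n \<subseteq> (\<Union>X\<in>F n. V X)"
    by (intro choice allI)
  then obtain F where F': "\<forall>n. finite (F n) \<and> F n \<subseteq> {X \<in> \<G>. W X \<subseteq> O' n \<and> V X \<inter> C \<noteq> {}}
      \<and> A n \<subseteq> (\<Union>X\<in>F n. V X)" ..
  note F = F'[rule_format, THEN conjunct1] F'[rule_format, THEN conjunct2, THEN conjunct1]
    F'[rule_format, THEN conjunct2, THEN conjunct2]
  let ?X = "\<Union>n. F n"
  have "C \<subseteq> (\<Union>X\<in>?X. V X)"
  proof
    fix p assume p: "p \<in> C"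
    define m where "m = (LEAST m. p \<in> K m)"
    have "\<exists>m. p \<in> K m" using K(3) by blast
    then have m: "p \<in> K m" unfolding m_def by (rule LeastI_ex)
    have "m \<noteq> 0" "m \<noteq> 1" using m K(4,5) by (metis empty_iff)+
    then have "m = (m - 2) + 2" by arith
    then obtain n where n: "m = n + 2" ..
    have "p \<notin> K (n + 1)" using not_less_Least[of "n + 1" "\<lambda>m. p \<in> K m"] n by (simp add: m_def)
    then have "p \<in> A n" using p m n interior_subset by (auto simp: A_def)
    then have "p \<in> (\<Union>X\<in>F n. V X)" using F(3)[of n] by (rule rev_subsetD)
    then show "p \<in> (\<Union>X\<in>?X. V X)" by auto
  qed
  moreover have "finite {X \<in> ?X. W X \<inter> B \<noteq> {}}" if compact_B: "compact B" for B
  proof -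
    have cover_B: "B \<subseteq> (\<Union>n. interior (K n))"
    proof
      fix p
      obtain n where "p \<in> K n" using K(3) by blast
      then have "p \<in> interior (K (Suc n))" using K(2)[of n] by blast
      then show "p \<in> (\<Union>n. interior (K n))" by blast
    qed
    obtain M where "M \<subseteq> UNIV" and M: "finite M" "B \<subseteq> (\<Union>n\<in>M. interior (K n))"
      by (rule compactE_image[OF compact_B open_interior cover_B])
    define b where "b = Max M"
    have b: "n \<le> b" if "n \<in> M" for n
      unfolding b_def by (rule Max_ge[OF M(1) that])
    have "interior (K n) \<subseteq> K b" if "n \<in> M" for n
      using interior_subset[of "K n"] K_mono[OF b[OF that]] by (rule subset_trans)
    then have "B \<subseteq> K b" using M(2) by blast
    have "{X \<in> ?X. W X \<inter> B \<noteq> {}} \<subseteq> (\<Union>n<b. F n)"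
    proof
      fix X assume "X \<in> {X \<in> ?X. W X \<inter> B \<noteq> {}}"
      then obtain n where n: "X \<in> F n" "W X \<inter> B \<noteq> {}" by blast
      have "n < b"
      proof (rule ccontr)
        assume "\<not> n < b"
        then have "B \<subseteq> K n" using \<open>B \<subseteq> K b\<close> K_mono[of b n] by auto
        moreover have "W X \<subseteq> O' n" using n(1) F(2) by blast
        ultimately show False using n(2) by (auto simp: O'_def)
      qed
      then show "X \<in> (\<Union>n<b. F n)" using n(1) by blast
    qed
    then show ?thesis by (rule finite_subset) (simp add: F(1))
  qed
  moreover have "countable ?X" using F(1) by (simp add: countable_finite)
  moreover have "X \<in> \<G> \<and> W X \<subseteq> U \<and> V X \<inter> C \<noteq> {}" if X: "X \<in> ?X" for X
  proof -
    obtain n where "X \<in> F n" using X by blast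
    then have "X \<in> {X \<in> \<G>. W X \<subseteq> O' n \<and> V X \<inter> C \<noteq> {}}" using F(2)[of n] by (rule rev_subsetD)
    then show ?thesis by (auto simp: O'_def)
  qed
  ultimately show ?thesis
  proof (intro exI[of _ ?X] conjI ballI allI impI)
    show "?X \<subseteq> \<G>" using \<open>\<And>X. X \<in> ?X \<Longrightarrow> _\<close> by (intro subsetI) simp
  qed simp_all
qed

context smooth_manifold
begin

text \<open>A triple consists of a chart, a centre and a radius in the coordinates of the chart. Room is left up
to three times the radius: the ball of radius \<open>2 * r\<close> around any point of \<open>ball a r\<close> contains
\<open>cball a r\<close> and lies in \<open>cball a (3 * r)\<close>, so a bump may be centred at any point of \<open>ball a r\<close>.\<close>

definition coordinate_balls :: "(('a, 'n) chart \<times> (real^'n) \<times> real) set"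
  where "coordinate_balls = {(c, a, r). c \<in> atlas \<and> r > 0 \<and> cball a (3 * r) \<subseteq> chart_im c}"

definition chart_ball :: "('a, 'n) chart \<times> (real^'n) \<times> real \<Rightarrow> 'a set"
  where "chart_ball = (\<lambda>(c, a, r). chart_inv c ` ball a r)"

definition chart_cball3 :: "('a, 'n) chart \<times> (real^'n) \<times> real \<Rightarrow> 'a set"
  where "chart_cball3 = (\<lambda>(c, a, r). chart_inv c ` cball a (3 * r))"

lemma compact_chart_inv_image:
  assumes "c \<in> atlas" "compact B" "B \<subseteq> chart_im c"
  shows "compact (chart_inv c ` B)"
  using homeo[OF assms(1)] assms(2,3)
  by (intro compact_continuous_image) (auto simp: homeomorphism_def intro: continuous_on_subset)

lemma open_chart_ball: "X \<in> coordinate_balls \<Longrightarrow> open (chart_ball X)"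
  by (cases X) (auto simp: coordinate_balls_def chart_ball_def subset_iff intro!: open_chart_inv_image)

lemma compact_chart_cball3: "X \<in> coordinate_balls \<Longrightarrow> compact (chart_cball3 X)"
  by (cases X) (auto simp: coordinate_balls_def chart_cball3_def intro!: compact_chart_inv_image)

lemma chart_ball_subset: "X \<in> coordinate_balls \<Longrightarrow> chart_ball X \<subseteq> chart_cball3 X"
  by (cases X) (auto simp: coordinate_balls_def chart_ball_def chart_cball3_def)

lemma small_coordinate_ball:
  fixes N :: "'a set"
  assumes "p \<in> N" "open N"
  shows "\<exists>X\<in>coordinate_balls. p \<in> chart_ball X \<and> chart_cball3 X \<subseteq> N"
proof -
  obtain c where c: "c \<in> atlas" "p \<in> chart_dom c" using cover by blast
  have "open (coords c ` (chart_dom c \<inter> N))" "coords c p \<in> coords c ` (chart_dom c \<inter> N)"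
    using open_coords_image[OF c(1) assms(2)] c(2) assms(1) by auto
  then obtain e where e: "e > 0" "cball (coords c p) e \<subseteq> coords c ` (chart_dom c \<inter> N)"
    using open_contains_cball by blast
  have "(c, coords c p, e / 3) \<in> coordinate_balls"
    using c e by (auto simp: coordinate_balls_def chart_im_def)
  moreover have "p \<in> chart_ball (c, coords c p, e / 3)"
    unfolding chart_ball_def using e chart_inv_coords[OF c] by (auto intro!: image_eqI[of _ _ "coords c p"])
  moreover have "chart_cball3 (c, coords c p, e / 3) \<subseteq> N"
  proof
    fix p' assume "p' \<in> chart_cball3 (c, coords c p, e / 3)"
    then obtain x where x: "x \<in> cball (coords c p) e" "p' = chart_inv c x"
      by (auto simp: chart_cball3_def)
    then obtain q where "q \<in> chart_dom c" "q \<in> N" "x = coords c q" using e(2) by blast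
    then show "p' \<in> N" using x(2) chart_inv_coords[OF c(1)] by simp
  qed
  ultimately show ?thesis by blast
qed

lemma compact_neighbourhood:
  fixes A :: "'a set"
  assumes "compact A"
  shows "\<exists>L. compact L \<and> A \<subseteq> interior L"
proof -
  have "A \<subseteq> (\<Union>X\<in>coordinate_balls. chart_ball X)"
    using small_coordinate_ball[of _ UNIV] by blast
  then obtain F where F: "F \<subseteq> coordinate_balls" "finite F" "A \<subseteq> (\<Union>X\<in>F. chart_ball X)"
    using compactE_image[OF assms, of coordinate_balls chart_ball] open_chart_ball by metis
  have "compact (\<Union>X\<in>F. chart_cball3 X)"
    using F(1,2) compact_chart_cball3 by (intro compact_UN) auto
  moreover have "(\<Union>X\<in>F. chart_ball X) \<subseteq> interior (\<Union>X\<in>F. chart_cball3 X)"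
  proof (rule interior_maximal)
    show "(\<Union>X\<in>F. chart_ball X) \<subseteq> (\<Union>X\<in>F. chart_cball3 X)"
      by (rule UN_mono) (use F(1) chart_ball_subset in blast)+
    show "open (\<Union>X\<in>F. chart_ball X)"
      using F(1) open_chart_ball by (intro open_UN) blast
  qed
  ultimately show ?thesis
    by (intro exI[of _ "\<Union>X\<in>F. chart_cball3 X"] conjI subset_trans[OF F(3)])
qed

lemma compact_exhaustion:
  "\<exists>K :: nat \<Rightarrow> 'a set. (\<forall>n. compact (K n)) \<and> (\<forall>n. K n \<subseteq> interior (K (Suc n)))
    \<and> (\<Union>n. K n) = UNIV \<and> K 0 = {} \<and> K 1 = {}"
proof -
  have op: "open N" if "N \<in> chart_ball ` coordinate_balls" for N
    using that open_chart_ball by blast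
  obtain \<F> where \<F>: "\<F> \<subseteq> chart_ball ` coordinate_balls" "countable \<F>" "\<Union>\<F> = \<Union>(chart_ball ` coordinate_balls)"
    by (rule Lindelof[OF op])
  have cov: "\<Union>\<F> = UNIV" using \<F>(3) small_coordinate_ball[of _ UNIV] by blast
  then have "\<F> \<noteq> {}" by auto
  have "\<exists>L. compact L \<and> from_nat_into \<F> n \<subseteq> L" for n
  proof -
    obtain X where "X \<in> coordinate_balls" "from_nat_into \<F> n = chart_ball X"
      using from_nat_into[OF \<open>\<F> \<noteq> {}\<close>, of n] \<F>(1) by blast
    then show ?thesis
      using compact_chart_cball3[of X] chart_ball_subset[of X] by auto
  qed
  then obtain B where B: "\<And>n. compact (B n)" "\<And>n. from_nat_into \<F> n \<subseteq> B n" by metis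
  have "\<exists>L. \<forall>n. compact (L n) \<and> L n \<union> B n \<subseteq> interior (L (Suc n))"
  proof (rule dependent_nat_choice)
    show "\<exists>L. compact L" using compact_empty by blast
    show "\<exists>L'. compact L' \<and> L \<union> B n \<subseteq> interior L'" if "compact L" for L n
      by (rule compact_neighbourhood) (use that B(1) in auto)
  qed
  then obtain L where L: "\<And>n. compact (L n)" "\<And>n. L n \<union> B n \<subseteq> interior (L (Suc n))" by blast
  define K where "K n = (if n < 2 then {} else L n)" for n
  have sub: "L n \<subseteq> L (Suc n)" for n using L(2)[of n] interior_subset by blast
  have L_mono: "m \<le> n \<Longrightarrow> L m \<subseteq> L n" for m n
    by (rule lift_Suc_mono_le[of L, OF sub])
  have "(\<Union>n. K n) = UNIV"
  proof -
    have "\<exists>n. p \<in> K n" for p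
    proof -
      obtain n where "p \<in> from_nat_into \<F> n"
        using cov \<F>(2) by (metis UNIV_I UnionE from_nat_into_surj)
      then have "p \<in> L (Suc n)" using B(2) L(2) interior_subset by blast
      then have "p \<in> L (Suc (Suc n))" using sub by blast
      then have "p \<in> K (Suc (Suc n))" by (simp add: K_def)
      then show ?thesis by blast
    qed
    then show ?thesis by blast
  qed
  moreover have "compact (K n)" "K n \<subseteq> interior (K (Suc n))" for n
    using L by (auto simp: K_def)
  ultimately show ?thesis
    by (intro exI[of _ K]) (auto simp: K_def)
qed

lemma nonempty_open_infinite:
  fixes N :: "'a set"
  assumes "open N" "p \<in> N"
  shows "infinite N"
proof
  assume "finite N"
  obtain c where c: "c \<in> atlas" "p \<in> chart_dom c" using cover by blast
  let ?B = "coords c ` (chart_dom c \<inter> N)"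
  have "open ?B" by (rule open_coords_image[OF c(1) assms(1)])
  moreover have "finite ?B" using \<open>finite N\<close> by simp
  ultimately have "?B = {}" using finite_imp_not_open by blast
  then show False using c(2) assms(2) by blast
qed

end

section \<open>Compensation of defects along successors\<close>

text \<open>The terms with index in \<open>B\<close> may be as small as \<open>- b i\<close>. Grouped by the value of \<open>s\<close>, these defects are
absorbed by the terms with index in \<open>s ` B\<close>, of which the surplus \<open>e\<close> remains.\<close>

lemma sum_with_compensation:
  fixes x b e :: "'i \<Rightarrow> real"
  assumes "finite I" "B \<subseteq> I" "s ` B \<subseteq> I" "s ` B \<inter> B = {}"
    and nonneg: "\<And>i. i \<in> I - B - s ` B \<Longrightarrow> x i \<ge> 0"
    and bad: "\<And>i. i \<in> B \<Longrightarrow> x i \<ge> - b i"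
    and good: "\<And>k. k \<in> s ` B \<Longrightarrow> x k \<ge> e k + (\<Sum>j\<in>{j \<in> B. s j = k}. b j)"
  shows "(\<Sum>i\<in>I. x i) \<ge> (\<Sum>k\<in>s ` B. e k)"
proof -
  have fin: "finite B" using assms(1,2) finite_subset by blast
  have "(\<Sum>i\<in>I. x i) = (\<Sum>i\<in>I - B - s ` B. x i) + ((\<Sum>k\<in>s ` B. x k) + (\<Sum>i\<in>B. x i))"
  proof -
    have "(\<Sum>i\<in>I. x i) = (\<Sum>i\<in>I - B. x i) + (\<Sum>i\<in>B. x i)"
      using assms(1,2) by (simp add: sum.subset_diff)
    moreover have "(\<Sum>i\<in>I - B. x i) = (\<Sum>i\<in>I - B - s ` B. x i) + (\<Sum>k\<in>s ` B. x k)"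
      by (rule sum.subset_diff) (use assms in auto)
    ultimately show ?thesis by simp
  qed
  moreover have "(\<Sum>i\<in>I - B - s ` B. x i) \<ge> 0" using nonneg by (rule sum_nonneg)
  moreover have "(\<Sum>i\<in>B. x i) \<ge> (\<Sum>i\<in>B. - b i)" using bad by (rule sum_mono)
  moreover have "(\<Sum>k\<in>s ` B. x k) \<ge> (\<Sum>k\<in>s ` B. e k + (\<Sum>j\<in>{j \<in> B. s j = k}. b j))"
    using good by (rule sum_mono)
  moreover have "(\<Sum>k\<in>s ` B. \<Sum>j\<in>{j \<in> B. s j = k}. b j) = (\<Sum>j\<in>B. b j)"
    by (rule sum.image_gen[OF fin, symmetric])
  ultimately show ?thesis by (simp add: sum.distrib sum_negf)
qed

text \<open>The equation for \<open>c k\<close> involves only predecessors of \<open>k\<close>, so it is a definition by well-founded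
recursion.\<close>

lemma ex_coefficients:
  fixes s :: "nat \<Rightarrow> nat" and e m b :: "nat \<Rightarrow> real"
  assumes wf: "wf {(i, s i) | i. True}"
    and m: "\<And>i. m i > 0" and e: "\<And>i. e i > 0" and b: "\<And>i. b i \<ge> 0"
  shows "\<exists>c. \<forall>k. c k > 0 \<and> c k * m k = e k + (\<Sum>j\<in>{j. s j = k}. c j * b j)"
proof -
  let ?R = "{(i, s i) | i. True}"
  define H where "H f k = (e k + (\<Sum>j\<in>{j. s j = k}. f j * b j)) / m k" for f k
  define c where "c = wfrec ?R H"
  have c: "c k = (e k + (\<Sum>j\<in>{j. s j = k}. c j * b j)) / m k" for k
  proof -
    have "c k = H (cut c ?R k) k"
      unfolding c_def by (rule wfrec[OF wf])
    also have "\<dots> = H c k"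
      unfolding H_def by (simp add: cut_def)
    finally show ?thesis by (simp add: H_def)
  qed
  have "c k > 0" for k
  proof (induction k rule: wf_induct_rule[OF wf])
    case (1 k)
    have "(\<Sum>j\<in>{j. s j = k}. c j * b j) \<ge> 0"
      using 1 b by (intro sum_nonneg mult_nonneg_nonneg) (auto intro: less_imp_le)
    then show ?case
      unfolding c[of k] using m e by (intro divide_pos_pos add_pos_nonneg)
  qed
  moreover have "c k * m k = e k + (\<Sum>j\<in>{j. s j = k}. c j * b j)" for k
    using c[of k] m[of k] by simp
  ultimately show ?thesis by blast
qed

text \<open>The set \<open>D i\<close> has to avoid its successor and its predecessors. These are finitely many, so finitely
many pairwise separations of the points \<open>q\<close> suffice.\<close>

lemma ex_separating_cores:
  fixes q :: "nat \<Rightarrow> 'a::t2_space"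
  assumes "inj q" "\<And>i. s i \<noteq> i" "\<And>k. finite {j. s j = k}" "\<And>i. open (O' i)" "\<And>i. q i \<in> O' i"
  shows "\<exists>D. \<forall>i. open (D i) \<and> q i \<in> D i \<and> D i \<subseteq> O' i \<and> D i \<inter> D (s i) = {}"
proof -
  have "\<exists>A B. i \<noteq> j \<longrightarrow> open A \<and> open B \<and> q i \<in> A \<and> q j \<in> B \<and> A \<inter> B = {}" for i j
  proof (cases "i = j")
    case False
    then have "q i \<noteq> q j" using assms(1) by (simp add: inj_eq)
    then show ?thesis using hausdorff[of "q i" "q j"] by blast
  qed simp
  then obtain A B where AB: "\<And>i j. i \<noteq> j \<Longrightarrow>
      open (A i j) \<and> open (B i j) \<and> q i \<in> A i j \<and> q j \<in> B i j \<and> A i j \<inter> B i j = {}"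
    by metis
  define N where "N i j = (if i < j then A i j else B j i)" for i j
  have N: "open (N i j)" "q i \<in> N i j" "N i j \<inter> N j i = {}" if "i \<noteq> j" for i j
    using AB[of i j] AB[of j i] that by (auto simp: N_def)
  define D where "D i = O' i \<inter> N i (s i) \<inter> (\<Inter>j\<in>{j. s j = i}. N i j)" for i
  have "open (D i)" for i
    unfolding D_def using assms N(1) by (intro open_Int open_INT) (auto, metis)
  moreover have "q i \<in> D i" for i
    unfolding D_def using assms N(2) by (auto, metis+)
  moreover have "D i \<inter> D (s i) = {}" for i
  proof -
    have "D i \<subseteq> N i (s i)" "D (s i) \<subseteq> N (s i) i" by (auto simp: D_def)
    then show ?thesis using N(3)[of i "s i"] assms(2)[of i] by fastforce
  qed
  ultimately show ?thesis by (intro exI[of _ D]) (auto simp: D_def)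
qed

lemma ex_injective_choice:
  fixes O' :: "nat \<Rightarrow> 'a set"
  assumes "\<And>i. infinite (O' i)"
  shows "\<exists>q. inj q \<and> (\<forall>i. q i \<in> O' i)"
proof -
  have "\<exists>q. \<forall>i. q i \<in> O' i - q ` {..<i}"
  proof (rule dependent_wellorder_choice)
    show "\<exists>r. r \<in> O' i - f ` {..<i}" for i f
      using assms[of i] by (metis Diff_infinite_finite equals0I finite.emptyI finite_imageI finite_lessThan)
    show "(r \<in> O' i - f ` {..<i}) = (r \<in> O' i - h ` {..<i})"
      if "\<And>j. j < i \<Longrightarrow> f j = h j" for r f h i
      using that by (auto simp: image_iff)
  qed
  then obtain q where q: "\<forall>i. q i \<in> O' i - q ` {..<i}" ..
  have neq: "q i \<noteq> q j" if "j < i" for i j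
    using q[rule_format, of i] that by auto
  have "inj q"
  proof (rule injI)
    show "i = j" if "q i = q j" for i j
      using neq[of i j] neq[of j i] that by (cases i j rule: linorder_cases) auto
  qed
  then show ?thesis using q by blast
qed

lemma continuous_pos_compact_bound:
  fixes f :: "'a::topological_space \<Rightarrow> real"
  assumes "continuous_on UNIV f" "compact A" "\<And>p. p \<in> A \<Longrightarrow> f p > 0"
  shows "\<exists>m>0. \<forall>p\<in>A. m \<le> f p"
proof (cases "A = {}")
  case False
  then obtain q where "q \<in> A" "\<And>p. p \<in> A \<Longrightarrow> f q \<le> f p"
    using continuous_attains_inf[OF assms(2) _ continuous_on_subset[OF assms(1)]] by blast
  then show ?thesis using assms(3) by blast
qed (use zero_less_one in blast)

context riemannian_manifold
begin

text \<open>The bump of radius \<open>2 * r\<close> around \<open>q\<close>, with the strict inequalities made uniform by compactness of the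
closed ball of radius \<open>r\<close>.\<close>

lemma ball_bump:
  assumes X: "X \<in> coordinate_balls" and D: "open D" "q \<in> D" "D \<subseteq> chart_ball X"
  shows "\<exists>\<alpha> m M. Cinf_fun atlas \<alpha> \<and> (\<forall>p. \<alpha> p \<ge> 0) \<and> (\<forall>p. p \<notin> chart_cball3 X \<longrightarrow> \<alpha> p = 0)
    \<and> m > 0 \<and> (\<forall>p\<in>chart_ball X. \<alpha> p \<ge> m) \<and> (\<forall>p\<in>chart_ball X - D. laplacian atlas g \<alpha> p \<ge> m)
    \<and> (\<forall>p. p \<notin> D \<longrightarrow> laplacian atlas g \<alpha> p \<ge> 0) \<and> M \<ge> 0 \<and> (\<forall>p. laplacian atlas g \<alpha> p \<ge> - M)"
proof -
  obtain c a r where X_eq: "X = (c, a, r)" by (cases X) auto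
  have c: "c \<in> atlas" and r: "r > 0" and im: "cball a (3 * r) \<subseteq> chart_im c"
    using X by (auto simp: X_eq coordinate_balls_def)
  obtain b where b: "b \<in> ball a r" "q = chart_inv c b"
    using D by (auto simp: X_eq chart_ball_def)
  have b_im: "b \<in> chart_im c" using b(1) im r by auto
  have q: "q \<in> chart_dom c" "coords c q = b"
    using b(2) chart_inv_in[OF c b_im] coords_chart_inv[OF c b_im] by simp_all
  have sub1: "cball a r \<subseteq> ball b (2 * r)"
  proof
    show "x \<in> ball b (2 * r)" if "x \<in> cball a r" for x
      using that b(1) dist_triangle3[of b x a] by simp
  qed
  have sub2: "cball b (2 * r) \<subseteq> cball a (3 * r)"
  proof
    show "x \<in> cball a (3 * r)" if "x \<in> cball b (2 * r)" for x
      using that b(1) dist_triangle[of a x b] by simp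
  qed
  define Z where "Z = chart_inv c ` cball a r"
  have "compact Z"
    unfolding Z_def using im r by (intro compact_chart_inv_image[OF c]) (auto simp: subset_iff)
  have V_Z: "chart_ball X \<subseteq> Z" by (auto simp: Z_def X_eq chart_ball_def)
  obtain \<alpha> where \<alpha>: "Cinf_fun atlas \<alpha>" "\<And>p. \<alpha> p \<ge> 0"
    "\<And>p. p \<notin> chart_inv c ` cball b (2 * r) \<Longrightarrow> \<alpha> p = 0"
    "\<And>p. p \<in> chart_inv c ` ball b (2 * r) \<Longrightarrow> \<alpha> p > 0"
    "\<And>p. p \<in> chart_inv c ` ball b (2 * r) - D \<Longrightarrow> laplacian atlas g \<alpha> p > 0"
    "\<And>p. p \<notin> D \<Longrightarrow> laplacian atlas g \<alpha> p \<ge> 0"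
    using bump_subharmonic_off_core[OF c q(1), of "2 * r" D] r D sub2 im unfolding q(2) by fastforce
  have Z_sub: "Z \<subseteq> chart_inv c ` ball b (2 * r)" unfolding Z_def using sub1 by (rule image_mono)
  have cont: "continuous_on UNIV \<alpha>" "continuous_on UNIV (laplacian atlas g \<alpha>)"
    using \<alpha>(1) by (auto simp: Cinf_fun_def intro: continuous_Ck_fun_0 continuous_laplacian)
  have "\<alpha> p > 0" if "p \<in> Z" for p using that Z_sub \<alpha>(4) by blast
  then obtain m1 where m1: "m1 > 0" "\<And>p. p \<in> Z \<Longrightarrow> m1 \<le> \<alpha> p"
    using continuous_pos_compact_bound[OF cont(1) \<open>compact Z\<close>] by blast
  have "laplacian atlas g \<alpha> p > 0" if "p \<in> Z - D" for p using that Z_sub \<alpha>(5) by blast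
  then obtain m2 where m2: "m2 > 0" "\<And>p. p \<in> Z - D \<Longrightarrow> m2 \<le> laplacian atlas g \<alpha> p"
    using continuous_pos_compact_bound[OF cont(2) compact_diff[OF \<open>compact Z\<close> D(1)]] by blast
  obtain M where M: "M \<ge> 0" "\<And>p. p \<in> Z \<Longrightarrow> - M \<le> laplacian atlas g \<alpha> p"
  proof -
    have "bounded (laplacian atlas g \<alpha> ` Z)"
      by (intro compact_imp_bounded compact_continuous_image continuous_on_subset[OF cont(2)] \<open>compact Z\<close>) simp
    then obtain B where B: "\<And>p. p \<in> Z \<Longrightarrow> \<bar>laplacian atlas g \<alpha> p\<bar> \<le> B"
      unfolding bounded_iff by auto
    show thesis
    proof (rule that[of "\<bar>B\<bar>"])
      show "- \<bar>B\<bar> \<le> laplacian atlas g \<alpha> p" if "p \<in> Z" for p using B[OF that] by linarith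
    qed simp
  qed
  show ?thesis
  proof (rule exI[of _ \<alpha>], rule exI[of _ "min m1 m2"], rule exI[of _ M], intro conjI allI ballI impI)
    show "\<alpha> p = 0" if "p \<notin> chart_cball3 X" for p
      using that sub2 by (intro \<alpha>(3)) (auto simp: X_eq chart_cball3_def)
    show "\<alpha> p \<ge> min m1 m2" if "p \<in> chart_ball X" for p
      using m1(2)[of p] V_Z that by auto
    show "laplacian atlas g \<alpha> p \<ge> min m1 m2" if "p \<in> chart_ball X - D" for p
      using m2(2)[of p] V_Z that by auto
    show "laplacian atlas g \<alpha> p \<ge> - M" for p
    proof (cases "p \<in> D")
      case True
      then show ?thesis using M(2) D(3) V_Z by blast
    next
      case False
      then show ?thesis using \<alpha>(6)[of p] M(1) by linarith
    qed
  qed (use \<alpha> m1(1) m2(1) M(1) in auto)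
qed

end

section \<open>Construction of the subharmonic function\<close>

context smooth_manifold
begin

text \<open>The balls can be indexed by the natural numbers since there are infinitely many of them: finitely
many would confine the closed set \<open>C\<close> to a compact one.\<close>

lemma locally_finite_ball_sequence:
  assumes "open U" "closed C" "\<not> compact C" "C \<subseteq> U"
  shows "\<exists>X :: nat \<Rightarrow> _. (\<forall>i. X i \<in> coordinate_balls \<and> chart_cball3 (X i) \<subseteq> U \<and> chart_ball (X i) \<inter> C \<noteq> {})
    \<and> C \<subseteq> (\<Union>i. chart_ball (X i)) \<and> (\<forall>A. compact A \<longrightarrow> finite {i. chart_cball3 (X i) \<inter> A \<noteq> {}})"
proof -
  obtain K :: "nat \<Rightarrow> 'a set" where K: "\<And>n. compact (K n)" "\<And>n. K n \<subseteq> interior (K (Suc n))"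
    "(\<Union>n. K n) = UNIV" "K 0 = {}" "K 1 = {}"
    using compact_exhaustion by (elim exE conjE) metis
  have "\<exists>\<X>\<subseteq>coordinate_balls. countable \<X> \<and> (\<forall>X\<in>\<X>. chart_cball3 X \<subseteq> U \<and> chart_ball X \<inter> C \<noteq> {})
      \<and> C \<subseteq> (\<Union>X\<in>\<X>. chart_ball X)
      \<and> (\<forall>A. compact A \<longrightarrow> finite {X \<in> \<X>. chart_cball3 X \<inter> A \<noteq> {}})"
    by (rule locally_finite_cover[OF K assms(2,4,1)]) (fact open_chart_ball, fact small_coordinate_ball)
  then obtain \<X> where sub: "\<X> \<subseteq> coordinate_balls" and cnt: "countable \<X>"
    and \<X>: "\<forall>X\<in>\<X>. chart_cball3 X \<subseteq> U \<and> chart_ball X \<inter> C \<noteq> {}"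
    and cov: "C \<subseteq> (\<Union>X\<in>\<X>. chart_ball X)"
    and fin: "\<forall>A. compact A \<longrightarrow> finite {X \<in> \<X>. chart_cball3 X \<inter> A \<noteq> {}}"
    by (elim exE conjE)
  have "infinite \<X>"
  proof
    assume "finite \<X>"
    then have "compact (\<Union>X\<in>\<X>. chart_cball3 X)"
      using sub compact_chart_cball3 by (intro compact_UN) auto
    moreover have "C \<subseteq> (\<Union>X\<in>\<X>. chart_cball3 X)"
      using cov by (rule subset_trans) (rule UN_mono[OF subset_refl], use sub chart_ball_subset in blast)
    ultimately show False
      using assms(2,3) compact_Int_closed[of "\<Union>X\<in>\<X>. chart_cball3 X" C] by (simp add: Int_absorb1)
  qed
  then have bij: "bij_betw (from_nat_into \<X>) UNIV \<X>" using cnt by (rule bij_betw_from_nat_into[rotated])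
  let ?X = "from_nat_into \<X>"
  have in_X: "?X i \<in> \<X>" for i using bij bij_betwE by blast
  have inj: "inj ?X" using bij by (rule bij_betw_imp_inj_on)
  show ?thesis
  proof (intro exI[of _ ?X] conjI allI impI)
    show "?X i \<in> coordinate_balls" "chart_cball3 (?X i) \<subseteq> U" "chart_ball (?X i) \<inter> C \<noteq> {}" for i
      using in_X[of i] sub \<X> by blast+
    have "C \<subseteq> (\<Union>X\<in>range ?X. chart_ball X)"
      using cov by (simp only: bij_betw_imp_surj_on[OF bij])
    then show "C \<subseteq> (\<Union>i. chart_ball (?X i))" by simp
    show "finite {i. chart_cball3 (?X i) \<inter> A \<noteq> {}}" if "compact A" for A
    proof -
      have eq: "{i. chart_cball3 (?X i) \<inter> A \<noteq> {}} = ?X -` {X \<in> \<X>. chart_cball3 X \<inter> A \<noteq> {}}"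
        using in_X by auto
      show ?thesis
        unfolding eq by (rule finite_vimageI[OF _ inj]) (use fin that in blast)
    qed
  qed
qed

text \<open>The overlap graph is connected because a set of indices closed under adjacency, together with its
complement, would split \<open>C\<close> into two disjoint relatively open parts.\<close>

lemma ex_escaping_successor:
  fixes V W :: "nat \<Rightarrow> 'a set"
  assumes C: "connected C" "C \<subseteq> (\<Union>i. V i)" and V: "\<And>i. open (V i)" "\<And>i. V i \<inter> C \<noteq> {}"
    and W: "\<And>i. V i \<subseteq> W i" "\<And>i. finite {j. W j \<inter> W i \<noteq> {}}"
  shows "\<exists>s. (\<forall>i. V i \<inter> V (s i) \<noteq> {}) \<and> wf {(i, s i) | i. True} \<and> (\<forall>k. finite {j. s j = k})"
proof -
  interpret infinite_graph "\<lambda>i j. V i \<inter> V j \<noteq> {}"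
  proof
    show "finite {j. V i \<inter> V j \<noteq> {}}" for i
      by (rule finite_subset[OF _ W(2)[of i]]) (use W(1) in blast)
    show "S = UNIV" if S: "S \<noteq> {}" and step: "\<And>i j. i \<in> S \<Longrightarrow> V i \<inter> V j \<noteq> {} \<Longrightarrow> j \<in> S" for S
    proof (rule ccontr)
      assume "S \<noteq> UNIV"
      then obtain i j where ij: "i \<in> S" "j \<notin> S" using S by blast
      let ?A = "\<Union>i\<in>S. V i" and ?B = "\<Union>i\<in>- S. V i"
      have "open ?A" "open ?B" by (simp_all add: V(1) open_UN)
      moreover have "?A \<inter> ?B \<inter> C = {}" using step by blast
      moreover have "C \<subseteq> ?A \<union> ?B" using C(2) by blast
      ultimately have "?A \<inter> C = {} \<or> ?B \<inter> C = {}" by (rule connectedD[OF C(1)])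
      moreover have "?A \<inter> C \<noteq> {}" using V(2)[of i] ij(1) by blast
      moreover have "?B \<inter> C \<noteq> {}" using V(2)[of j] ij(2) by blast
      ultimately show False by simp
    qed
  qed blast
  obtain s where s: "\<And>i. V i \<inter> V (s i) \<noteq> {}" "wf {(i, s i) | i. True}"
    using ex_wf_successor by blast
  have "finite {j. s j = k}" for k
    by (rule finite_subset[OF _ locally_finite[of k]]) (use s(1) in blast)
  then show ?thesis using s by blast
qed

end

context riemannian_manifold
begin

text \<open>Let \<open>B\<close> be the set of bumps whose core contains the point \<open>p\<close>. The defects of these bumps are
compensated at \<open>p\<close> by their successors, whose cores do not contain \<open>p\<close>, and each successor leaves
a surplus above \<open>\<rho> p\<close>. If \<open>B\<close> is empty, no term is negative, and any ball \<open>V i\<close> that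
contains \<open>p\<close> contributes such a surplus.\<close>

theorem ex_subharmonic_dominating:
  fixes \<rho> :: "'a \<Rightarrow> real"
  assumes U: "open U" and C: "closed C" "connected C" "\<not> compact C" "C \<subseteq> U"
    and \<rho>: "continuous_on UNIV \<rho>" "\<And>p. \<rho> p > 0"
  shows "\<exists>\<phi>. (\<forall>p. \<phi> p \<ge> 0) \<and> Cinf_fun atlas \<phi> \<and> subharmonic atlas g \<phi>
    \<and> (\<forall>p. p \<notin> U \<longrightarrow> \<phi> p = 0) \<and> (\<forall>p\<in>C. \<phi> p > \<rho> p \<and> laplacian atlas g \<phi> p > \<rho> p)"
proof -
  obtain X :: "nat \<Rightarrow> _" where
      "\<forall>i. X i \<in> coordinate_balls \<and> chart_cball3 (X i) \<subseteq> U \<and> chart_ball (X i) \<inter> C \<noteq> {}"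
    and X_C: "C \<subseteq> (\<Union>i. chart_ball (X i))"
    and X_fin: "\<forall>A. compact A \<longrightarrow> finite {i. chart_cball3 (X i) \<inter> A \<noteq> {}}"
    using locally_finite_ball_sequence[OF U C(1,3,4)] by (elim exE conjE)
  then have X: "X i \<in> coordinate_balls" "chart_cball3 (X i) \<subseteq> U" "chart_ball (X i) \<inter> C \<noteq> {}" for i
    by simp_all
  define V where "V i = chart_ball (X i)" for i
  define W where "W i = chart_cball3 (X i)" for i
  have open_V: "open (V i)" and V_W: "V i \<subseteq> W i" and compact_W: "compact (W i)"
    and W_U: "W i \<subseteq> U" and V_C: "V i \<inter> C \<noteq> {}" for i
    using open_chart_ball[OF X(1)] chart_ball_subset[OF X(1)] compact_chart_cball3[OF X(1)] X(2,3)
    by (simp_all add: V_def W_def)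
  have cover_C: "C \<subseteq> (\<Union>i. V i)" using X_C by (simp add: V_def)
  have fin_W: "finite {i. W i \<inter> A \<noteq> {}}" if "compact A" for A using X_fin that by (simp add: W_def)
  obtain s where s: "\<forall>i. V i \<inter> V (s i) \<noteq> {}" and wf: "wf {(i, s i) | i. True}"
    and "\<forall>k. finite {j. s j = k}"
    using ex_escaping_successor[OF C(2) cover_C open_V V_C V_W fin_W[OF compact_W]]
    by (elim exE conjE)
  then have fin_s: "finite {j. s j = k}" for k by simp
  have s_neq: "s i \<noteq> i" for i
  proof
    assume "s i = i"
    moreover have "(i, s i) \<in> {(i, s i) | i. True}" by blast
    ultimately have "(i, i) \<in> {(i, s i) | i. True}" by (simp only:)
    with wf show False by (rule wf_not_refl[THEN notE])
  qed
  have infinite_overlap: "infinite (V i \<inter> V (s i))" for i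
    using nonempty_open_infinite[OF open_Int[OF open_V open_V]] s by blast
  obtain q where q: "inj q" "\<forall>i. q i \<in> V i \<inter> V (s i)"
    using ex_injective_choice[of "\<lambda>i. V i \<inter> V (s i)", OF infinite_overlap] by (elim exE conjE)
  obtain D where "\<forall>i. open (D i) \<and> q i \<in> D i \<and> D i \<subseteq> V i \<inter> V (s i) \<and> D i \<inter> D (s i) = {}"
    using ex_separating_cores[of q s "\<lambda>i. V i \<inter> V (s i)",
        OF q(1) s_neq fin_s open_Int[OF open_V open_V] q(2)[rule_format]]
    by (elim exE)
  then have D: "open (D i)" "q i \<in> D i" "D i \<subseteq> V i \<inter> V (s i)" "D i \<inter> D (s i) = {}" for i
    by simp_all
  define bump where "bump i \<alpha> m M \<longleftrightarrow> Cinf_fun atlas \<alpha> \<and> (\<forall>p. \<alpha> p \<ge> 0) \<and> (\<forall>p. p \<notin> W i \<longrightarrow> \<alpha> p = 0)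
    \<and> m > 0 \<and> (\<forall>p\<in>V i. \<alpha> p \<ge> m) \<and> (\<forall>p\<in>V i - D i. laplacian atlas g \<alpha> p \<ge> m)
    \<and> (\<forall>p. p \<notin> D i \<longrightarrow> laplacian atlas g \<alpha> p \<ge> 0) \<and> M \<ge> 0 \<and> (\<forall>p. laplacian atlas g \<alpha> p \<ge> - M)"
    for i \<alpha> m M
  have "\<exists>\<alpha> m M. bump i \<alpha> m M" for i
    unfolding bump_def V_def W_def by (rule ball_bump[OF X(1) D(1,2)]) (use D(3) in \<open>auto simp: V_def\<close>)
  then obtain \<alpha> m M where "\<And>i. bump i (\<alpha> i) (m i) (M i)"
    by metis
  then have \<alpha>: "\<And>i. Cinf_fun atlas (\<alpha> i)" "\<And>i p. \<alpha> i p \<ge> 0" "\<And>i p. p \<notin> W i \<Longrightarrow> \<alpha> i p = 0"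
    and m: "\<And>i. m i > 0" "\<And>i p. p \<in> V i \<Longrightarrow> \<alpha> i p \<ge> m i"
      "\<And>i p. p \<in> V i \<Longrightarrow> p \<notin> D i \<Longrightarrow> laplacian atlas g (\<alpha> i) p \<ge> m i"
    and L0: "\<And>i p. p \<notin> D i \<Longrightarrow> laplacian atlas g (\<alpha> i) p \<ge> 0"
    and M: "\<And>i. M i \<ge> 0" "\<And>i p. laplacian atlas g (\<alpha> i) p \<ge> - M i"
    by (simp_all add: bump_def)
  have "\<exists>R. \<forall>p\<in>W i. \<rho> p \<le> R" for i
  proof -
    have "bounded (\<rho> ` W i)"
      by (intro compact_imp_bounded compact_continuous_image continuous_on_subset[OF \<rho>(1)] compact_W) simp
    then obtain B where "\<And>p. p \<in> W i \<Longrightarrow> \<bar>\<rho> p\<bar> \<le> B" unfolding bounded_iff by auto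
    then show ?thesis by (meson abs_le_D1)
  qed
  then obtain R where R: "\<And>i p. p \<in> W i \<Longrightarrow> \<rho> p \<le> R i" by metis
  \<comment> \<open>A positive number above \<open>\<rho>\<close> on \<open>V i\<close>: the surplus required of the \<open>i\<close>-th term.\<close>
  define e where "e i = \<bar>R i\<bar> + 1" for i
  have e_pos: "e i > 0" for i by (simp add: e_def)
  have e_\<rho>: "\<rho> p < e i" if "p \<in> V i" for i p
    using R[of p i] V_W that unfolding e_def by fastforce
  obtain c where c: "\<And>k. c k > 0" "\<And>k. c k * m k = e k + (\<Sum>j\<in>{j. s j = k}. c j * M j)"
    using ex_coefficients[of s m e M, OF wf m(1) e_pos M(1)] by blast
  have cm_e: "c k * m k \<ge> e k" for k
    unfolding c(2) using c(1) M(1) by (simp add: sum_nonneg less_imp_le)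
  define \<phi> where "\<phi> p = (\<Sum>i\<in>{i. p \<in> W i}. c i * \<alpha> i p)" for p
  have fin_p: "finite {i. p \<in> W i}" for p
    using fin_W[of "{p}"] by simp
  \<comment> \<open>Near each point \<open>\<phi>\<close> agrees with a fixed finite sum, although its index set varies with the point.\<close>
  have local_sum: "\<exists>N I. open N \<and> p \<in> N \<and> finite I \<and> {i. p \<in> W i} \<subseteq> I \<and> (\<forall>p'\<in>N. \<phi> p' = (\<Sum>i\<in>I. c i * \<alpha> i p'))" for p
  proof -
    obtain A where A: "compact A" "{p} \<subseteq> interior A" using compact_neighbourhood[of "{p}"] by auto
    let ?I = "{i. W i \<inter> A \<noteq> {}}"
    have "\<phi> p' = (\<Sum>i\<in>?I. c i * \<alpha> i p')" if "p' \<in> interior A" for p'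
      unfolding \<phi>_def
      by (rule sum.mono_neutral_left[OF fin_W[OF A(1)]])
        (use that interior_subset[of A] \<alpha>(3) in auto)
    moreover have "{i. p \<in> W i} \<subseteq> ?I" using A(2) interior_subset[of A] by blast
    ultimately show ?thesis
      using A fin_W[OF A(1)] by (intro exI[of _ "interior A"] exI[of _ ?I]) auto
  qed
  have Ck_\<alpha>: "Ck_fun atlas k (\<alpha> i)" for k i using \<alpha>(1) by (simp add: Cinf_fun_def)
  have smooth: "Ck_fun atlas k \<phi>" for k
  proof (rule Ck_fun_locally)
    fix p
    obtain N I where N: "open N" "p \<in> N" "\<forall>p'\<in>N. \<phi> p' = (\<Sum>i\<in>I. c i * \<alpha> i p')"
      using local_sum[of p] by (elim exE conjE)
    have "Ck_fun atlas k (\<lambda>p'. \<Sum>i\<in>I. c i * \<alpha> i p')"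
      by (rule Ck_fun_sum[OF Ck_\<alpha>])
    with N show "\<exists>N h. open N \<and> p \<in> N \<and> Ck_fun atlas k h \<and> (\<forall>q\<in>N. \<phi> q = h q)"
      by (intro exI conjI)
  qed
  have lap: "laplacian atlas g \<phi> p \<ge> 0 \<and> (\<forall>i. p \<in> V i \<longrightarrow> laplacian atlas g \<phi> p > \<rho> p)" for p
  proof -
    obtain N I where N: "open N" "p \<in> N" "finite I" "{i. p \<in> W i} \<subseteq> I"
      "\<forall>p'\<in>N. \<phi> p' = (\<Sum>i\<in>I. c i * \<alpha> i p')"
      using local_sum[of p] by (elim exE conjE)
    let ?x = "\<lambda>i. c i * laplacian atlas g (\<alpha> i) p"
    have "laplacian atlas g \<phi> p = laplacian atlas g (\<lambda>p. \<Sum>i\<in>I. c i * \<alpha> i p) p"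
      by (rule laplacian_cong[OF N(1,2) N(5)[rule_format] smooth Ck_fun_sum[OF Ck_\<alpha>]])
    then have lap_eq: "laplacian atlas g \<phi> p = (\<Sum>i\<in>I. ?x i)"
      by (simp add: laplacian_sum[OF Ck_\<alpha>])
    define B where "B = {i. p \<in> D i}"
    have in_I: "i \<in> I" if "p \<in> V i" for i using that V_W N(4) by blast
    have B_V: "p \<in> V i" "p \<in> V (s i)" "p \<notin> D (s i)" if "i \<in> B" for i
      using that D(3,4)[of i] by (auto simp: B_def)
    have nonneg: "?x i \<ge> 0" if "i \<notin> B" for i
      using L0[of p i] c(1)[of i] that by (simp add: B_def)
    have strong: "?x i \<ge> c i * m i" if "p \<in> V i" "i \<notin> B" for i
      using m(3)[of p i] c(1)[of i] that by (simp add: B_def)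
    have "B \<subseteq> I" using B_V in_I by blast
    then have fin_B: "finite B" using N(3) finite_subset by blast
    have sum_ge: "(\<Sum>i\<in>I. ?x i) \<ge> (\<Sum>k\<in>s ` B. e k)"
    proof (rule sum_with_compensation[where b = "\<lambda>i. c i * M i"])
      show "s ` B \<subseteq> I" using B_V in_I by blast
      show sB: "s ` B \<inter> B = {}" using B_V(3) by (auto simp: B_def)
      show "?x i \<ge> - (c i * M i)" for i
        using mult_left_mono[OF M(2)[of i p], of "c i"] c(1)[of i] by simp
      show "?x k \<ge> e k + (\<Sum>j\<in>{j \<in> B. s j = k}. c j * M j)" if "k \<in> s ` B" for k
      proof -
        have "(\<Sum>j\<in>{j \<in> B. s j = k}. c j * M j) \<le> (\<Sum>j\<in>{j. s j = k}. c j * M j)"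
          by (rule sum_mono2[OF fin_s]) (use c(1) M(1) in \<open>auto simp: less_imp_le\<close>)
        moreover have "?x k \<ge> c k * m k"
          by (rule strong) (use that B_V sB in blast)+
        ultimately show ?thesis using c(2)[of k] by linarith
      qed
    qed (use N(3) \<open>B \<subseteq> I\<close> nonneg in auto)
    have "(\<Sum>k\<in>s ` B. e k) \<ge> 0" using e_pos by (simp add: sum_nonneg less_imp_le)
    moreover have "\<rho> p < (\<Sum>i\<in>I. ?x i)" if i: "p \<in> V i" for i
    proof (cases "B = {}")
      case True
      then have "e i \<le> ?x i" using strong[OF i] cm_e[of i] by simp
      also have "\<dots> \<le> (\<Sum>i\<in>I. ?x i)"
        using True nonneg by (intro member_le_sum N(3) in_I[OF i]) auto
      finally show ?thesis using e_\<rho>[OF i] by linarith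
    next
      case False
      then obtain j where "j \<in> B" by blast
      then have "e (s j) \<le> (\<Sum>k\<in>s ` B. e k)"
        using e_pos fin_B by (intro member_le_sum) (auto simp: less_imp_le)
      then show ?thesis using e_\<rho>[OF B_V(2)[OF \<open>j \<in> B\<close>]] sum_ge by linarith
    qed
    ultimately show ?thesis using sum_ge unfolding lap_eq by force
  qed
  have nonneg: "\<phi> p \<ge> 0" for p
    unfolding \<phi>_def using c(1) \<alpha>(2) by (intro sum_nonneg mult_nonneg_nonneg) (auto simp: less_imp_le)
  have large: "\<phi> p > \<rho> p" if "p \<in> V i" for p i
  proof -
    have "e i \<le> c i * m i" by (rule cm_e)
    also have "\<dots> \<le> c i * \<alpha> i p" using m(2)[OF that] c(1)[of i] by simp
    also have "\<dots> \<le> \<phi> p"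
      unfolding \<phi>_def using that V_W c(1) \<alpha>(2)
      by (intro member_le_sum[of i _ "\<lambda>i. c i * \<alpha> i p"] fin_p) (auto simp: less_imp_le)
    finally show ?thesis using e_\<rho>[OF that] by linarith
  qed
  show ?thesis
  proof (intro exI[of _ \<phi>] conjI allI ballI impI)
    show "subharmonic atlas g \<phi>" using smooth lap by (simp add: subharmonic_def)
    show "Cinf_fun atlas \<phi>" using smooth by (simp add: Cinf_fun_def)
    show "\<phi> p = 0" if "p \<notin> U" for p
    proof -
      have "{i. p \<in> W i} = {}" using that W_U by blast
      then show ?thesis by (simp add: \<phi>_def)
    qed
    show "\<phi> p > \<rho> p" "laplacian atlas g \<phi> p > \<rho> p" if "p \<in> C" for p
      using that cover_C large lap by blast+
  qed (rule nonneg)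
qed

end

theorem theorem0p2:
  fixes atlas :: "('a::{t2_space, second_countable_topology}, 'n::finite) chart set"
    and g :: "('a, 'n) chart \<Rightarrow> 'a \<Rightarrow> real^'n^'n"
    and U C :: "'a set"
    and \<rho> :: "'a \<Rightarrow> real"
  assumes "riemannian_manifold atlas g"
    and "connected (UNIV :: 'a set)" and "\<not> compact (UNIV :: 'a set)"
    and "open U" and "connected U"
    and "closed C" and "connected C" and "\<not> compact C" and "C \<subseteq> U"
    and "continuous_on UNIV \<rho>" and "\<forall>p. \<rho> p > 0"
  shows "\<exists>\<phi> :: 'a \<Rightarrow> real.
    (\<forall>p. \<phi> p \<ge> 0) \<and> Cinf_fun atlas \<phi> \<and> subharmonic atlas g \<phi> \<and>
    (\<forall>p. p \<notin> U \<longrightarrow> \<phi> p = 0) \<and>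
    (\<forall>p\<in>C. \<phi> p > \<rho> p \<and> laplacian atlas g \<phi> p > \<rho> p)"
proof -
  interpret riemannian_manifold atlas g by fact
  show ?thesis
    by (rule ex_subharmonic_dominating) (use assms in auto)
qed

end
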